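(* Let $K$ be an associative commutative unital ring, and let $A$ be a Poisson algebra over $K$ that is Poisson--Noetherian and possesses a Poisson-pair $(\alpha,\delta)$. Then the Poisson Ore extension $A[x;\alpha,\delta]_{\mathrm{P}}$ and the Poisson Laurent Ore extension $A[x^{\pm};\alpha,\delta]_{\mathrm{P}}$ are Poisson--Noetherian.
   Context: Throughout, $K$ is an associative commutative unital ring. A Poisson algebra is an associative commutative unital $K$-algebra $A$ equipped with a $K$-bilinear operation $\{\cdot,\cdot\}_A\colon A\times A\to A$ (the Poisson bracket) such that for all $a,b,c\in A$: $\{a,a\}_A=0$; $\{a,\{b,c\}_A\}_A=\{\{a,b\}_A,c\}_A+\{b,\{a,c\}_A\}_A$; and $\{a,bc\}_A=\{a,b\}_Ac+b\{a,c\}_A$. A derivation of a $K$-algebra always means a $K$-linear derivation. A derivation $\delta$ of $A$ is a Poisson derivation if $\delta(\{a,b\}_A)=\{\delta(a),b\}_A+\{a,\delta(b)\}_A$ for all $a,b\in A$. A Poisson-pair on $A$ is a pair $(\alpha,\delta)$ of maps $A\to A$ where $\alpha$ is a Poisson derivation of $A$ and $\delta$ is a derivation of $A$ such that, for all $a,b\in A$, $$\delta(\{a,b\}_A)-\{\delta(a),b\}_A-\{a,\delta(b)\}_A=\delta(a)\alpha(b)-\alpha(a)\delta(b).$$ Poisson Ore extension: for a Poisson-pair $(\alpha,\delta)$ on $A$, it is known that there is a unique Poisson bracket $\{\cdot,\cdot\}$ on the ordinary polynomial algebra $A[x]$ that extends $\{\cdot,\cdot\}_A$ and satisfies $\{a,x\}=\alpha(a)x+\delta(a)$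 for all $a\in A$. The resulting Poisson algebra is denoted $A[x;\alpha,\delta]_{\mathrm{P}}$. Its bracket is given by $$\{ax^i,bx^j\}=(\{a,b\}_A+j\alpha(a)b-ia\alpha(b))x^{i+j}+(j\delta(a)b-ia\delta(b))x^{i+j-1}$$ for all $a,b\in A$ and $i,j\in\mathbb{N}=\{0,1,2,\ldots\}$, where the second summand is omitted when $i=j=0$. Poisson Laurent Ore extension: this bracket extends uniquely to a Poisson bracket on the Laurent polynomial algebra $A[x^{\pm}]$, for which the displayed formula holds for all $a,b\in A$ and $i,j\in\mathbb{Z}$. The resulting Poisson algebra is denoted $A[x^{\pm};\alpha,\delta]_{\mathrm{P}}$. An ideal $I$ of a Poisson algebra $A$ is a Poisson ideal if $\{A,I\}_A\subseteq I$. For $S\subseteq A$, a Poisson ideal is generated by $S$ if it is the intersection of all Poisson ideals of $A$ containing $S$. $A$ is Poisson--Noetherian if every Poisson ideal of $A$ is finitely generated as a Poisson ideal; equivalently, every ascending chain of Poisson ideals of $A$ stabilizes; equivalently, every nonempty collection of Poisson ideals of $A$ contains a maximal element with respect to inclusion. *)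

theory Defs
  imports "HOL-Algebra.UnivPoly"
begin

section \<open>Poisson algebras\<close>

record ('k, 'a) poisson = "('k, 'a) module" +
  pbracket :: "['a, 'a] \<Rightarrow> 'a"  (\<open>\<lbrace>_,/ _\<rbrace>\<index>\<close>)

locale poisson_algebra = algebra K A for K and A (structure) +
  assumes pbracket_closed:
      "\<lbrakk>a \<in> carrier A; b \<in> carrier A\<rbrakk> \<Longrightarrow> \<lbrace>a, b\<rbrace> \<in> carrier A"
    and pbracket_add_left:
      "\<lbrakk>a \<in> carrier A; b \<in> carrier A; c \<in> carrier A\<rbrakk> \<Longrightarrow> \<lbrace>a \<oplus> b, c\<rbrace> = \<lbrace>a, c\<rbrace> \<oplus> \<lbrace>b, c\<rbrace>"
    and pbracket_add_right:
      "\<lbrakk>a \<in> carrier A; b \<in> carrier A; c \<in> carrier A\<rbrakk> \<Longrightarrow> \<lbrace>a, b \<oplus> c\<rbrace> = \<lbrace>a, b\<rbrace> \<oplus> \<lbrace>a, c\<rbrace>"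
    and pbracket_smult_left:
      "\<lbrakk>k \<in> carrier K; a \<in> carrier A; b \<in> carrier A\<rbrakk> \<Longrightarrow> \<lbrace>k \<odot> a, b\<rbrace> = k \<odot> \<lbrace>a, b\<rbrace>"
    and pbracket_smult_right:
      "\<lbrakk>k \<in> carrier K; a \<in> carrier A; b \<in> carrier A\<rbrakk> \<Longrightarrow> \<lbrace>a, k \<odot> b\<rbrace> = k \<odot> \<lbrace>a, b\<rbrace>"
    and pbracket_self:
      "a \<in> carrier A \<Longrightarrow> \<lbrace>a, a\<rbrace> = \<zero>"
    and pbracket_jacobi:
      "\<lbrakk>a \<in> carrier A; b \<in> carrier A; c \<in> carrier A\<rbrakk> \<Longrightarrow>
        \<lbrace>a, \<lbrace>b, c\<rbrace>\<rbrace> = \<lbrace>\<lbrace>a, b\<rbrace>, c\<rbrace> \<oplus> \<lbrace>b, \<lbrace>a, c\<rbrace>\<rbrace>"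
    and pbracket_leibniz:
      "\<lbrakk>a \<in> carrier A; b \<in> carrier A; c \<in> carrier A\<rbrakk> \<Longrightarrow>
        \<lbrace>a, b \<otimes> c\<rbrace> = \<lbrace>a, b\<rbrace> \<otimes> c \<oplus> b \<otimes> \<lbrace>a, c\<rbrace>"

locale poisson_ideal = ideal I A for I and A (structure) +
  assumes pbracket_mem: "\<lbrakk>a \<in> carrier A; x \<in> I\<rbrakk> \<Longrightarrow> \<lbrace>a, x\<rbrace> \<in> I"

definition gen_poisson_ideal :: "('k, 'a, 'm) poisson_scheme \<Rightarrow> 'a set \<Rightarrow> 'a set"
  where "gen_poisson_ideal A S = \<Inter>{I. poisson_ideal I A \<and> S \<subseteq> I}"

locale poisson_noetherian = poisson_algebra K A for K and A (structure) +
  assumes finitely_generated: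
    "poisson_ideal I A \<Longrightarrow> \<exists>S. finite S \<and> S \<subseteq> carrier A \<and> I = gen_poisson_ideal A S"


section \<open>Derivations and Poisson-pairs\<close>

locale derivation = algebra K A for K and A (structure) and d +
  assumes der_closed: "a \<in> carrier A \<Longrightarrow> d a \<in> carrier A"
    and der_add: "\<lbrakk>a \<in> carrier A; b \<in> carrier A\<rbrakk> \<Longrightarrow> d (a \<oplus> b) = d a \<oplus> d b"
    and der_smult: "\<lbrakk>k \<in> carrier K; a \<in> carrier A\<rbrakk> \<Longrightarrow> d (k \<odot> a) = k \<odot> d a"
    and der_mult: "\<lbrakk>a \<in> carrier A; b \<in> carrier A\<rbrakk> \<Longrightarrow> d (a \<otimes> b) = d a \<otimes> b \<oplus> a \<otimes> d b"

locale poisson_derivation = poisson_algebra K A + derivation K A d for K and A (structure) and d +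
  assumes der_pbracket:
    "\<lbrakk>a \<in> carrier A; b \<in> carrier A\<rbrakk> \<Longrightarrow> d \<lbrace>a, b\<rbrace> = \<lbrace>d a, b\<rbrace> \<oplus> \<lbrace>a, d b\<rbrace>"

locale poisson_pair = poisson_derivation K A \<alpha> + \<delta>: derivation K A \<delta>
  for K and A (structure) and \<alpha> and \<delta> +
  assumes pair_identity:
    "\<lbrakk>a \<in> carrier A; b \<in> carrier A\<rbrakk> \<Longrightarrow>
      \<delta> \<lbrace>a, b\<rbrace> \<ominus> \<lbrace>\<delta> a, b\<rbrace> \<ominus> \<lbrace>a, \<delta> b\<rbrace> = \<delta> a \<otimes> \<alpha> b \<ominus> \<alpha> a \<otimes> \<delta> b"


section \<open>Poisson Ore and Poisson Laurent Ore extensions\<close>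

text \<open>
  The bracket of the monomials \<open>a x^i\<close> and \<open>b x^j\<close> has coefficient
  \<^term>\<open>ore_coeff_hi A \<alpha> a i b j\<close> at exponent \<open>i + j\<close> and
  \<^term>\<open>ore_coeff_lo A \<delta> a i b j\<close> at exponent \<open>i + j - 1\<close>. Exponents are integers
  so that they serve ordinary and Laurent polynomials alike.
\<close>

definition ore_coeff_hi ::
    "('k, 'a, 'm) poisson_scheme \<Rightarrow> ('a \<Rightarrow> 'a) \<Rightarrow> 'a \<Rightarrow> int \<Rightarrow> 'a \<Rightarrow> int \<Rightarrow> 'a"
  where "ore_coeff_hi A \<alpha> a i b j =
    (\<lbrace>a, b\<rbrace>\<^bsub>A\<^esub> \<oplus>\<^bsub>A\<^esub> [j] \<cdot>\<^bsub>A\<^esub> (\<alpha> a \<otimes>\<^bsub>A\<^esub> b)) \<ominus>\<^bsub>A\<^esub> [i] \<cdot>\<^bsub>A\<^esub> (a \<otimes>\<^bsub>A\<^esub> \<alpha> b)"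

definition ore_coeff_lo ::
    "('k, 'a, 'm) poisson_scheme \<Rightarrow> ('a \<Rightarrow> 'a) \<Rightarrow> 'a \<Rightarrow> int \<Rightarrow> 'a \<Rightarrow> int \<Rightarrow> 'a"
  where "ore_coeff_lo A \<delta> a i b j =
    [j] \<cdot>\<^bsub>A\<^esub> (\<delta> a \<otimes>\<^bsub>A\<^esub> b) \<ominus>\<^bsub>A\<^esub> [i] \<cdot>\<^bsub>A\<^esub> (a \<otimes>\<^bsub>A\<^esub> \<delta> b)"

text \<open>
  The ring structure of \<open>A[x]\<close> is that of \<^term>\<open>UP A\<close>; only the scalar multiplication
  is replaced, since \<open>A[x]\<close> is to be an algebra over \<open>K\<close> rather than over \<open>A\<close>.
\<close>

definition ore_bracket ::
    "('k, 'a, 'm) poisson_scheme \<Rightarrow> ('a \<Rightarrow> 'a) \<Rightarrow> ('a \<Rightarrow> 'a) \<Rightarrow> (nat \<Rightarrow> 'a) \<Rightarrow> (nat \<Rightarrow> 'a) \<Rightarrow> nat \<Rightarrow> 'a"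
  where "ore_bracket A \<alpha> \<delta> p q =
    (\<Oplus>\<^bsub>UP A\<^esub>i \<in> {..deg A p}. \<Oplus>\<^bsub>UP A\<^esub>j \<in> {..deg A q}.
      monom (UP A) (ore_coeff_hi A \<alpha> (coeff (UP A) p i) (int i) (coeff (UP A) q j) (int j)) (i + j)
      \<oplus>\<^bsub>UP A\<^esub>
      (if i = 0 \<and> j = 0 then \<zero>\<^bsub>UP A\<^esub>
       else monom (UP A) (ore_coeff_lo A \<delta> (coeff (UP A) p i) (int i) (coeff (UP A) q j) (int j)) (i + j - 1)))"

definition poisson_ore ::
    "('k, 'a, 'm) poisson_scheme \<Rightarrow> ('a \<Rightarrow> 'a) \<Rightarrow> ('a \<Rightarrow> 'a) \<Rightarrow> ('k, nat \<Rightarrow> 'a) poisson"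
  where "poisson_ore A \<alpha> \<delta> = \<lparr>
    carrier = carrier (UP A),
    mult = mult (UP A),
    one = one (UP A),
    zero = zero (UP A),
    add = add (UP A),
    smult = (\<lambda>k p i. k \<odot>\<^bsub>A\<^esub> coeff (UP A) p i),
    pbracket = ore_bracket A \<alpha> \<delta>\<rparr>"

definition laurent_supp :: "('a, 'm) ring_scheme \<Rightarrow> (int \<Rightarrow> 'a) \<Rightarrow> int set"
  where "laurent_supp R f = {i. f i \<noteq> \<zero>\<^bsub>R\<^esub>}"

definition laurent_monom :: "('a, 'm) ring_scheme \<Rightarrow> 'a \<Rightarrow> int \<Rightarrow> int \<Rightarrow> 'a"
  where "laurent_monom R a i = (\<lambda>n. if n = i then a else \<zero>\<^bsub>R\<^esub>)"

definition laurent_ring :: "('a, 'm) ring_scheme \<Rightarrow> (int \<Rightarrow> 'a) ring"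
  where "laurent_ring R = \<lparr>
    carrier = {f \<in> UNIV \<rightarrow> carrier R. finite (laurent_supp R f)},
    mult = (\<lambda>f g n. \<Oplus>\<^bsub>R\<^esub>i \<in> laurent_supp R f. f i \<otimes>\<^bsub>R\<^esub> g (n - i)),
    one = laurent_monom R \<one>\<^bsub>R\<^esub> 0,
    zero = (\<lambda>n. \<zero>\<^bsub>R\<^esub>),
    add = (\<lambda>f g n. f n \<oplus>\<^bsub>R\<^esub> g n)\<rparr>"

definition laurent_ore_bracket ::
    "('k, 'a, 'm) poisson_scheme \<Rightarrow> ('a \<Rightarrow> 'a) \<Rightarrow> ('a \<Rightarrow> 'a) \<Rightarrow> (int \<Rightarrow> 'a) \<Rightarrow> (int \<Rightarrow> 'a) \<Rightarrow> int \<Rightarrow> 'a"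
  where "laurent_ore_bracket A \<alpha> \<delta> f g =
    (\<Oplus>\<^bsub>laurent_ring A\<^esub>i \<in> laurent_supp A f. \<Oplus>\<^bsub>laurent_ring A\<^esub>j \<in> laurent_supp A g.
      laurent_monom A (ore_coeff_hi A \<alpha> (f i) i (g j) j) (i + j)
      \<oplus>\<^bsub>laurent_ring A\<^esub>
      laurent_monom A (ore_coeff_lo A \<delta> (f i) i (g j) j) (i + j - 1))"

definition poisson_laurent_ore ::
    "('k, 'a, 'm) poisson_scheme \<Rightarrow> ('a \<Rightarrow> 'a) \<Rightarrow> ('a \<Rightarrow> 'a) \<Rightarrow> ('k, int \<Rightarrow> 'a) poisson"
  where "poisson_laurent_ore A \<alpha> \<delta> = \<lparr>
    carrier = carrier (laurent_ring A),
    mult = mult (laurent_ring A),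
    one = one (laurent_ring A),
    zero = zero (laurent_ring A),
    add = add (laurent_ring A),
    smult = (\<lambda>k f i. k \<odot>\<^bsub>A\<^esub> f i),
    pbracket = laurent_ore_bracket A \<alpha> \<delta>\<rparr>"

end

theory Submission
  imports Defs
begin

text \<open>
  The argument is Hilbert's basis theorem with Poisson ideals in place of ideals. For a Poisson ideal \<open>I\<close> of
  \<open>A[x; \<alpha>, \<delta>]\<close> let \<open>L\<^sub>n\<close> be the set of coefficients at \<open>x^n\<close> of the elements of \<open>I\<close> of degree
  at most \<open>n\<close>. The bracket of a constant \<open>a\<close> with \<open>b x^n + \<dots>\<close> has leading coefficient
  \<open>{a, b} + n \<alpha>(a) b\<close>; since \<open>L\<^sub>n\<close> is an ideal, it is even a Poisson ideal of \<open>A\<close>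
  (\<open>poisson_ideal_lead_coeffs\<close>). The \<open>L\<^sub>n\<close> increase, hence become constant, and each has finitely many
  generators. Elements of \<open>I\<close> with these finitely many leading coefficients generate a Poisson ideal
  \<open>J \<subseteq> I\<close> with the same \<open>L\<^sub>n\<close>, and then \<open>J = I\<close> by descent on the degree
  (\<open>eq_of_lead_coeffs_subset\<close>). A Poisson ideal of the Laurent extension is generated by its contraction to
  \<open>A[x; \<alpha>, \<delta>]\<close>, because every Laurent polynomial becomes an ordinary one after multiplication by a power
  of \<open>x\<close>, which is a unit.

  Most of the work goes into showing that the two extensions are Poisson algebras at all. The explicit formula
  on monomials is reorganised as follows. Let \<open>{\<cdot>, \<cdot>}\<^sub>0\<close> be the coefficientwise bracket on the Laurent
  polynomials, for which the axioms can be read off from monomials, let \<open>D = x d/dx\<close> and let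
  \<open>X = \<alpha> + x^(-1) \<delta>\<close>. Then the Ore bracket is
  \<open>{f, g} = {f, g}\<^sub>0 + X(f) D(g) - D(f) X(g)\<close>
  (\<open>twisted_bracket_monom\<close>, \<open>laurent_ore_bracket_eq\<close>). All axioms but the Jacobi identity are immediate
  from the derivation property. The Jacobi identity follows from two relations: the defect of \<open>X\<close> as a
  Poisson derivation, which is the identity of a Poisson-pair, and \<open>DX - XD = \<alpha> - X\<close>. They are the
  hypotheses of the locale \<open>poisson_twist\<close>, in which the Jacobi sum is shown to telescope
  (\<open>twisted_bracket_cyclic\<close>). The ordinary extension embeds in the Laurent extension and inherits the axioms
  (\<open>poisson_algebra_embedding\<close>).
\<close>

section \<open>Derivations and Poisson brackets\<close>

lemma cring_cong:
  assumes "cring R" "carrier S = carrier R" "mult S = mult R" "one S = one R" "zero S = zero R" "add S = add R"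
  shows "cring S"
proof -
  interpret cring R by fact
  have "abelian_group S"
    using assms(2-) by (intro abelian_groupI) (auto simp: a_ac intro: add.l_inv_ex)
  moreover have "comm_monoid S"
    using assms(2-) by (intro comm_monoidI) (simp_all add: m_ac)
  ultimately show ?thesis
    using assms(2-) by (intro cringI) (simp_all add: l_distr)
qed

lemma additive_add_pow:
  assumes "abelian_group G" "abelian_group H"
    and "\<And>x. x \<in> carrier G \<Longrightarrow> h x \<in> carrier H"
    and "\<And>x y. \<lbrakk>x \<in> carrier G; y \<in> carrier G\<rbrakk> \<Longrightarrow> h (x \<oplus>\<^bsub>G\<^esub> y) = h x \<oplus>\<^bsub>H\<^esub> h y"
    and "x \<in> carrier G"
  shows "h ([(n :: int)] \<cdot>\<^bsub>G\<^esub> x) = [n] \<cdot>\<^bsub>H\<^esub> h x"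
  unfolding add_pow_def
  using assms by (intro hom_int_pow) (auto simp: hom_def abelian_group.a_group)

lemma additive_finsum:
  assumes "abelian_group G" "abelian_group H"
    and h: "\<And>x. x \<in> carrier G \<Longrightarrow> h x \<in> carrier H"
    and add: "\<And>x y. \<lbrakk>x \<in> carrier G; y \<in> carrier G\<rbrakk> \<Longrightarrow> h (x \<oplus>\<^bsub>G\<^esub> y) = h x \<oplus>\<^bsub>H\<^esub> h y"
    and "finite S" "F \<in> S \<rightarrow> carrier G"
  shows "h (\<Oplus>\<^bsub>G\<^esub>i \<in> S. F i) = (\<Oplus>\<^bsub>H\<^esub>i \<in> S. h (F i))"
  using assms(5,6)
proof (induction S rule: finite_induct)
  interpret G: abelian_group G by fact
  interpret H: abelian_group H by fact
  case empty
  have "h \<zero>\<^bsub>G\<^esub> \<oplus>\<^bsub>H\<^esub> h \<zero>\<^bsub>G\<^esub> = h \<zero>\<^bsub>G\<^esub>"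
    using add[of "\<zero>\<^bsub>G\<^esub>" "\<zero>\<^bsub>G\<^esub>"] by simp
  then show ?case using h[of "\<zero>\<^bsub>G\<^esub>"] by (simp add: H.add.l_cancel_one)
next
  interpret G: abelian_group G by fact
  interpret H: abelian_group H by fact
  case (insert j S)
  then have "F j \<in> carrier G" "F \<in> S \<rightarrow> carrier G" by auto
  moreover from this have "(\<lambda>i. h (F i)) \<in> S \<rightarrow> carrier H" "h (F j) \<in> carrier H" using h by auto
  ultimately show ?case
    using insert by (simp add: add G.finsum_insert H.finsum_insert)
qed

context derivation
begin

lemma der_zero: "d \<zero> = \<zero>"
proof -
  have "d (\<zero> \<oplus> \<zero>) = d \<zero> \<oplus> d \<zero>" by (rule der_add) simp_all
  then show ?thesis
    using der_closed[of \<zero>] by (simp add: M.add.l_cancel_one)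
qed

lemma der_a_inv: "a \<in> carrier A \<Longrightarrow> d (\<ominus> a) = \<ominus> d a"
  using der_add[of "\<ominus> a" a] by (simp add: M.l_neg der_zero der_closed M.minus_equality)

lemma der_minus:
  "\<lbrakk>a \<in> carrier A; b \<in> carrier A\<rbrakk> \<Longrightarrow> d (a \<ominus> b) = d a \<ominus> d b"
  by (simp add: a_minus_def der_add der_a_inv)

end

context poisson_algebra
begin

lemma pbracket_antisym:
  assumes "a \<in> carrier A" "b \<in> carrier A"
  shows "\<lbrace>b, a\<rbrace> = \<ominus> \<lbrace>a, b\<rbrace>"
proof -
  have "\<lbrace>b, a\<rbrace> \<oplus> \<lbrace>a, b\<rbrace> = \<lbrace>a \<oplus> b, a \<oplus> b\<rbrace>"
    using assms pbracket_self[of a] pbracket_self[of b]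
    by (simp add: pbracket_add_left pbracket_add_right pbracket_closed)
  also have "\<dots> = \<zero>"
    using assms by (simp add: pbracket_self)
  finally show ?thesis
    using assms M.minus_equality pbracket_closed by metis
qed

lemma pbracket_a_inv_right:
  assumes "a \<in> carrier A" "b \<in> carrier A"
  shows "\<lbrace>a, \<ominus> b\<rbrace> = \<ominus> \<lbrace>a, b\<rbrace>"
proof -
  have "\<lbrace>a, \<zero> \<oplus> \<zero>\<rbrace> = \<lbrace>a, \<zero>\<rbrace> \<oplus> \<lbrace>a, \<zero>\<rbrace>"
    using assms by (intro pbracket_add_right) simp_all
  then have "\<lbrace>a, \<zero>\<rbrace> = \<zero>"
    using assms pbracket_closed[of a \<zero>] by (simp add: M.add.l_cancel_one)
  then show ?thesis
    using assms pbracket_add_right[of a "\<ominus> b" b]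
    by (simp add: M.l_neg pbracket_closed M.minus_equality)
qed

text \<open>
  The cyclic form of the Jacobi identity. It treats the three arguments alike, so that correction terms
  can be compared by rotating them.
\<close>

lemma pbracket_cyclic:
  assumes "a \<in> carrier A" "b \<in> carrier A" "c \<in> carrier A"
  shows "\<lbrace>a, \<lbrace>b, c\<rbrace>\<rbrace> \<oplus> \<lbrace>b, \<lbrace>c, a\<rbrace>\<rbrace> \<oplus> \<lbrace>c, \<lbrace>a, b\<rbrace>\<rbrace> = \<zero>"
proof -
  have "\<lbrace>b, \<lbrace>c, a\<rbrace>\<rbrace> = \<ominus> \<lbrace>b, \<lbrace>a, c\<rbrace>\<rbrace>" "\<lbrace>c, \<lbrace>a, b\<rbrace>\<rbrace> = \<ominus> \<lbrace>\<lbrace>a, b\<rbrace>, c\<rbrace>"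
    using assms pbracket_antisym[of a c] pbracket_antisym[of "\<lbrace>a, b\<rbrace>" c]
    by (simp_all add: pbracket_a_inv_right pbracket_closed)
  moreover have "\<lbrace>\<lbrace>a, b\<rbrace>, c\<rbrace> \<in> carrier A" "\<lbrace>b, \<lbrace>a, c\<rbrace>\<rbrace> \<in> carrier A"
    using assms by (simp_all add: pbracket_closed)
  ultimately show ?thesis
    unfolding pbracket_jacobi[OF assms] by algebra
qed

lemma pbracket_minus_right:
  "\<lbrakk>a \<in> carrier A; b \<in> carrier A; c \<in> carrier A\<rbrakk> \<Longrightarrow> \<lbrace>a, b \<ominus> c\<rbrace> = \<lbrace>a, b\<rbrace> \<ominus> \<lbrace>a, c\<rbrace>"
  by (simp add: a_minus_def pbracket_add_right pbracket_a_inv_right)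

end

section \<open>Twisting a Poisson bracket by two derivations\<close>

text \<open>
  The bivector \<open>\<pi>\<close> of a Poisson bracket is to be replaced by \<open>\<pi> + X \<and> D\<close>, where \<open>D\<close> is a Poisson
  derivation and \<open>X\<close> a derivation. The hypotheses \<open>X_pbracket\<close> and \<open>D_X\<close> say that \<open>X\<close> fails to preserve \<open>\<pi>\<close> by
  the term \<open>X \<and> c\<close>, and that \<open>DX - XD = c - X\<close>. In the Jacobi identity of the new bracket the first
  defect produces the trivector \<open>X \<and> c \<and> D\<close>, and the commutator produces the same trivector with the
  opposite sign (its part \<open>X\<close> is killed by \<open>X \<and> X = 0\<close>), so that the Jacobi identity survives.
\<close>

locale poisson_twist = D: poisson_derivation K A D + X: derivation K A X
  for K and A (structure) and D and X +
  fixes c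
  assumes c_closed: "f \<in> carrier A \<Longrightarrow> c f \<in> carrier A"
    and X_pbracket: "\<lbrakk>f \<in> carrier A; g \<in> carrier A\<rbrakk> \<Longrightarrow>
      X \<lbrace>f, g\<rbrace> = (\<lbrace>X f, g\<rbrace> \<oplus> \<lbrace>f, X g\<rbrace>) \<oplus> (X f \<otimes> c g \<ominus> c f \<otimes> X g)"
    and D_X: "f \<in> carrier A \<Longrightarrow> D (X f) = (X (D f) \<oplus> c f) \<ominus> X f"
begin

definition twisted_bracket where
  "twisted_bracket f g = \<lbrace>f, g\<rbrace> \<oplus> (X f \<otimes> D g \<ominus> D f \<otimes> X g)"

lemmas closed = D.der_closed X.der_closed c_closed D.pbracket_closed

lemma X_D_pbracket:
  assumes "f \<in> carrier A" "g \<in> carrier A"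
  shows "D \<lbrace>f, g\<rbrace> = \<lbrace>f, D g\<rbrace> \<ominus> \<lbrace>g, D f\<rbrace>"
    and "X \<lbrace>f, g\<rbrace> = (\<lbrace>f, X g\<rbrace> \<ominus> \<lbrace>g, X f\<rbrace>) \<oplus> (X f \<otimes> c g \<ominus> c f \<otimes> X g)"
proof -
  have "\<lbrace>D f, g\<rbrace> = \<ominus> \<lbrace>g, D f\<rbrace>" "\<lbrace>X f, g\<rbrace> = \<ominus> \<lbrace>g, X f\<rbrace>"
    using assms by (simp_all add: D.pbracket_antisym[of g] closed)
  then show "D \<lbrace>f, g\<rbrace> = \<lbrace>f, D g\<rbrace> \<ominus> \<lbrace>g, D f\<rbrace>"
    and "X \<lbrace>f, g\<rbrace> = (\<lbrace>f, X g\<rbrace> \<ominus> \<lbrace>g, X f\<rbrace>) \<oplus> (X f \<otimes> c g \<ominus> c f \<otimes> X g)"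
    using assms by (simp_all add: D.der_pbracket X_pbracket D.M.minus_eq closed D.M.a_comm)
qed

text \<open>
  This is the operator \<open>(D + 1) X\<close>. In terms of it \<open>DX = Y - X\<close> and \<open>XD + c = Y\<close>, so that \<open>c\<close> and
  \<open>XD\<close> occur in the Jacobi identity only through \<open>Y\<close>.
\<close>

definition Y where "Y f = X (D f) \<oplus> c f"

text \<open>
  A nested bracket \<open>{f, {g, h}}\<close> of the twisted structure differs from the old one by a sum of products,
  which is of the form \<open>W f g h - W g h f\<close>. Such a difference disappears when it is summed over the
  cyclic rotations of \<open>f, g, h\<close>, and this is why the Jacobi identity carries over. The potential \<open>W\<close> is the
  sum of the following two functions; the first collects the products in which an old bracket
  occurs, the second those without one.
\<close>

definition bracket_potential where
  "bracket_potential f g h = ((\<lbrace>f, X g\<rbrace> \<otimes> D h \<ominus> X f \<otimes> \<lbrace>h, D g\<rbrace>) \<ominus> \<lbrace>f, D g\<rbrace> \<otimes> X h) \<oplus> D f \<otimes> \<lbrace>h, X g\<rbrace>"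
definition product_potential where
  "product_potential f g h = X f \<otimes> ((Y g \<otimes> D h \<oplus> D g \<otimes> X h) \<ominus> D (D g) \<otimes> X h) \<oplus> D f \<otimes> (Y g \<otimes> X h
      \<ominus> X (X g) \<otimes> D h)"

lemma potential_closed: "\<lbrakk>f \<in> carrier A; g \<in> carrier A; h \<in> carrier A\<rbrakk> \<Longrightarrow> bracket_potential f g h \<in> carrier A"
  "\<lbrakk>f \<in> carrier A; g \<in> carrier A; h \<in> carrier A\<rbrakk> \<Longrightarrow> product_potential f g h \<in> carrier A"
  by (simp_all add: bracket_potential_def product_potential_def Y_def closed)

text \<open>
  Ordering the terms by the factors \<open>X f\<close> and \<open>D f\<close> makes the rotated potential comparable with
  the unrotated one.
\<close>

lemma product_potential_rotated: assumes "f \<in> carrier A" "g \<in> carrier A" "h \<in> carrier A"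
  shows "product_potential g h f = X f \<otimes> ((X g \<otimes> D h \<oplus> D g \<otimes> Y h) \<ominus> X g \<otimes> D (D h)) \<oplus> D f \<otimes> (X g \<otimes> Y h
      \<ominus> D g \<otimes> X (X h))"
proof -
  have "X f \<in> carrier A" "X g \<in> carrier A" "X h \<in> carrier A"
    "D f \<in> carrier A" "D g \<in> carrier A" "D h \<in> carrier A"
    "Y h \<in> carrier A" "D (D h) \<in> carrier A" "X (X h) \<in> carrier A"
    using assms by (simp_all add: closed Y_def)
  then show ?thesis unfolding product_potential_def by algebra
qed

lemma twisted_bracket_nested:
  assumes "f \<in> carrier A" "g \<in> carrier A" "h \<in> carrier A"
  shows "twisted_bracket f (twisted_bracket g h) = \<lbrace>f, \<lbrace>g, h\<rbrace>\<rbrace> \<oplus> ((bracket_potential f g h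
      \<oplus> product_potential f g h) \<ominus> (bracket_potential g h f \<oplus> product_potential g h f))"
proof -
  \<comment> \<open>In the values of \<open>D\<close> and \<open>X\<close> at the twisted bracket of \<open>g\<close> and \<open>h\<close>, \<open>?BD\<close> and
    \<open>?BX\<close> are the parts with an old bracket, and \<open>?ND\<close> and \<open>?NX\<close> the parts without one.\<close>
  let ?BD = "\<lbrace>g, D h\<rbrace> \<ominus> \<lbrace>h, D g\<rbrace>" and ?BX = "\<lbrace>g, X h\<rbrace> \<ominus> \<lbrace>h, X g\<rbrace>"
  let ?ND = "((Y g \<ominus> X g) \<otimes> D h \<oplus> X g \<otimes> D (D h)) \<ominus> (D (D g) \<otimes> X h \<oplus> D g \<otimes> (Y h \<ominus> X h))"
  let ?NX = "(X g \<otimes> Y h \<ominus> Y g \<otimes> X h) \<oplus> (X (X g) \<otimes> D h \<ominus> D g \<otimes> X (X h))"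
  let ?F = "(\<lbrace>f, X g\<rbrace> \<otimes> D h \<oplus> X g \<otimes> \<lbrace>f, D h\<rbrace>) \<ominus> (\<lbrace>f, D g\<rbrace> \<otimes> X h \<oplus> D g \<otimes> \<lbrace>f, X h\<rbrace>)"
  have in_A: "X f \<in> carrier A" "X g \<in> carrier A" "X h \<in> carrier A"
    "D f \<in> carrier A" "D g \<in> carrier A" "D h \<in> carrier A"
    "Y g \<in> carrier A" "Y h \<in> carrier A" "D (D g) \<in> carrier A" "D (D h) \<in> carrier A"
    "X (X g) \<in> carrier A" "X (X h) \<in> carrier A"
    using assms by (simp_all add: closed Y_def)
  have br_in_A: "\<lbrace>f, X g\<rbrace> \<in> carrier A" "\<lbrace>f, D g\<rbrace> \<in> carrier A" "\<lbrace>f, X h\<rbrace> \<in> carrier A" "\<lbrace>f, D h\<rbrace> \<in> carrier A"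
    "\<lbrace>g, X h\<rbrace> \<in> carrier A" "\<lbrace>g, D h\<rbrace> \<in> carrier A" "\<lbrace>h, X g\<rbrace> \<in> carrier A" "\<lbrace>h, D g\<rbrace> \<in> carrier A"
        "\<lbrace>f, \<lbrace>g, h\<rbrace>\<rbrace> \<in> carrier A"
    using assms by (simp_all add: closed)
  have "\<lbrace>f, twisted_bracket g h\<rbrace> = \<lbrace>f, \<lbrace>g, h\<rbrace>\<rbrace> \<oplus> ?F"
    using assms by (simp add: twisted_bracket_def closed D.pbracket_add_right D.pbracket_minus_right
        D.pbracket_leibniz)
  moreover have "D (twisted_bracket g h) = ?BD \<oplus> ?ND"
    using assms by (simp add: twisted_bracket_def closed D.der_add D.der_minus D.der_mult X_D_pbracket D_X
        Y_def)
  moreover have "X (twisted_bracket g h) = ?BX \<oplus> ?NX"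
  proof -
    have "X (twisted_bracket g h) = (?BX \<oplus> (X g \<otimes> c h \<ominus> c g \<otimes> X h)) \<oplus> ((X (X g) \<otimes> D h \<oplus> X g \<otimes> X (D h))
        \<ominus> (X (D g) \<otimes> X h \<oplus> D g \<otimes> X (X h)))"
      using assms by (simp add: twisted_bracket_def closed X.der_add X.der_minus X.der_mult X_D_pbracket)
    also have "\<dots> = ?BX \<oplus> ((X g \<otimes> c h \<ominus> c g \<otimes> X h) \<oplus> ((X (X g) \<otimes> D h \<oplus> X g \<otimes> X (D h)) \<ominus> (X (D g) \<otimes> X h
        \<oplus> D g \<otimes> X (X h))))"
      using assms by (simp add: closed D.M.a_assoc)
    also have "(X g \<otimes> c h \<ominus> c g \<otimes> X h) \<oplus> ((X (X g) \<otimes> D h \<oplus> X g \<otimes> X (D h)) \<ominus> (X (D g) \<otimes> X h \<oplus> D g \<otimes> X (X h)))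
        = ?NX"
    proof -
      have "c g \<in> carrier A" "c h \<in> carrier A" "X (D g) \<in> carrier A" "X (D h) \<in> carrier A"
        using assms by (simp_all add: closed)
      with in_A show ?thesis unfolding Y_def by algebra
    qed
    finally show ?thesis .
  qed
  ultimately have "twisted_bracket f (twisted_bracket g h) = (\<lbrace>f, \<lbrace>g, h\<rbrace>\<rbrace> \<oplus> ?F) \<oplus> (X f \<otimes> (?BD \<oplus> ?ND)
      \<ominus> D f \<otimes> (?BX \<oplus> ?NX))"
    by (simp add: twisted_bracket_def[of f])
  also have "\<dots> = \<lbrace>f, \<lbrace>g, h\<rbrace>\<rbrace> \<oplus> ((?F \<oplus> (X f \<otimes> ?BD \<ominus> D f \<otimes> ?BX)) \<oplus> (X f \<otimes> ?ND \<ominus> D f \<otimes> ?NX))"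
  proof -
    have regroup: "(p \<oplus> F) \<oplus> (x \<otimes> (b \<oplus> n) \<ominus> d \<otimes> (b' \<oplus> n')) = p \<oplus> ((F \<oplus> (x \<otimes> b \<ominus> d \<otimes> b')) \<oplus> (x \<otimes> n \<ominus> d \<otimes> n'))"
      if "p \<in> carrier A" "F \<in> carrier A" "x \<in> carrier A" "d \<in> carrier A" "b \<in> carrier A" "n \<in> carrier A"
          "b' \<in> carrier A" "n' \<in> carrier A"
      for p F x d b n b' n'
      using that by algebra
    show ?thesis by (rule regroup) (use in_A br_in_A in simp_all)
  qed
  also have "?F \<oplus> (X f \<otimes> ?BD \<ominus> D f \<otimes> ?BX) = bracket_potential f g h \<ominus> bracket_potential g h f"
    unfolding bracket_potential_def using in_A br_in_A by algebra
  also have "X f \<otimes> ?ND \<ominus> D f \<otimes> ?NX = product_potential f g h \<ominus> product_potential g h f"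
  proof -
    \<comment> \<open>\<open>?P\<close> and \<open>?Q\<close> are the coefficients of \<open>X f\<close> and \<open>D f\<close> in the potential, \<open>?P'\<close> and \<open>?Q'\<close>
      those in the rotated potential.\<close>
    let ?P = "(Y g \<otimes> D h \<oplus> D g \<otimes> X h) \<ominus> D (D g) \<otimes> X h" and ?P' = "(X g \<otimes> D h \<oplus> D g \<otimes> Y h) \<ominus> X g \<otimes> D (D h)"
    let ?Q = "Y g \<otimes> X h \<ominus> X (X g) \<otimes> D h" and ?Q' = "X g \<otimes> Y h \<ominus> D g \<otimes> X (X h)"
    have "?ND = ?P \<ominus> ?P'" "?NX = ?Q' \<ominus> ?Q"
      using in_A by algebra+
    moreover have "x \<otimes> (p \<ominus> p') \<ominus> d \<otimes> (q' \<ominus> q) = (x \<otimes> p \<oplus> d \<otimes> q) \<ominus> (x \<otimes> p' \<oplus> d \<otimes> q')"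
      if "p \<in> carrier A" "p' \<in> carrier A" "x \<in> carrier A" "d \<in> carrier A" "q \<in> carrier A" "q' \<in> carrier A"
      for p p' x d q q'
      using that by algebra
    ultimately show ?thesis
      unfolding product_potential_rotated[OF assms] unfolding product_potential_def using in_A by simp
  qed
  also have "(bracket_potential f g h \<ominus> bracket_potential g h f) \<oplus> (product_potential f g h
      \<ominus> product_potential g h f) = (bracket_potential f g h \<oplus> product_potential f g h)
      \<ominus> (bracket_potential g h f \<oplus> product_potential g h f)"
    using potential_closed[OF assms] potential_closed[OF assms(2,3,1)] by algebra
  finally show ?thesis .
qed

text \<open>
  The three differences of potentials telescope.
\<close>

lemma twisted_bracket_cyclic:
  assumes "f \<in> carrier A" "g \<in> carrier A" "h \<in> carrier A"
  shows "twisted_bracket f (twisted_bracket g h) \<oplus> twisted_bracket g (twisted_bracket h f)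
      \<oplus> twisted_bracket h (twisted_bracket f g) = \<zero>"
proof -
  define W where "W a b d = bracket_potential a b d \<oplus> product_potential a b d" for a b d
  have W: "W f g h \<in> carrier A" "W g h f \<in> carrier A" "W h f g \<in> carrier A"
    and P: "\<lbrace>f, \<lbrace>g, h\<rbrace>\<rbrace> \<in> carrier A" "\<lbrace>g, \<lbrace>h, f\<rbrace>\<rbrace> \<in> carrier A" "\<lbrace>h, \<lbrace>f, g\<rbrace>\<rbrace> \<in> carrier A"
    using assms by (simp_all add: W_def potential_closed closed)
  have "twisted_bracket f (twisted_bracket g h) \<oplus> twisted_bracket g (twisted_bracket h f)
      \<oplus> twisted_bracket h (twisted_bracket f g)
    = (\<lbrace>f, \<lbrace>g, h\<rbrace>\<rbrace> \<oplus> (W f g h \<ominus> W g h f)) \<oplus> (\<lbrace>g, \<lbrace>h, f\<rbrace>\<rbrace> \<oplus> (W g h f \<ominus> W h f g)) \<oplus> (\<lbrace>h, \<lbrace>f, g\<rbrace>\<rbrace> \<oplus> (W h f g \<ominus> W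
        f g h))"
    using assms by (simp add: twisted_bracket_nested W_def)
  also have "\<dots> = \<lbrace>f, \<lbrace>g, h\<rbrace>\<rbrace> \<oplus> \<lbrace>g, \<lbrace>h, f\<rbrace>\<rbrace> \<oplus> \<lbrace>h, \<lbrace>f, g\<rbrace>\<rbrace>"
    using W P by algebra
  also have "\<dots> = \<zero>"
    using assms by (rule D.pbracket_cyclic)
  finally show ?thesis .
qed

lemma twisted_bracket_closed:
  "\<lbrakk>f \<in> carrier A; g \<in> carrier A\<rbrakk> \<Longrightarrow> twisted_bracket f g \<in> carrier A"
  by (simp add: twisted_bracket_def closed)

lemma twisted_bracket_antisym:
  assumes "f \<in> carrier A" "g \<in> carrier A"
  shows "twisted_bracket g f = \<ominus> twisted_bracket f g"
proof -
  have "\<lbrace>f, g\<rbrace> \<in> carrier A" "X f \<in> carrier A" "X g \<in> carrier A" "D f \<in> carrier A" "D g \<in> carrier A"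
    using assms by (simp_all add: closed)
  then show ?thesis
    unfolding twisted_bracket_def D.pbracket_antisym[OF assms] by algebra
qed

lemma twisted_bracket_self:
  assumes "f \<in> carrier A"
  shows "twisted_bracket f f = \<zero>"
  using assms by (simp add: twisted_bracket_def closed D.pbracket_self D.m_comm[of "D f"] D.M.minus_eq
      D.M.r_neg)

lemma twisted_bracket_add_right:
  assumes "f \<in> carrier A" "g \<in> carrier A" "h \<in> carrier A"
  shows "twisted_bracket f (g \<oplus> h) = twisted_bracket f g \<oplus> twisted_bracket f h"
proof -
  have "\<lbrace>f, g\<rbrace> \<in> carrier A" "\<lbrace>f, h\<rbrace> \<in> carrier A" "X f \<in> carrier A" "X g \<in> carrier A" "X h \<in> carrier A"
    "D f \<in> carrier A" "D g \<in> carrier A" "D h \<in> carrier A"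
    using assms by (simp_all add: closed)
  then show ?thesis
    unfolding twisted_bracket_def D.pbracket_add_right[OF assms] D.der_add[OF assms(2,3)] X.der_add[OF
        assms(2,3)]
    by algebra
qed

lemma twisted_bracket_add_left:
  assumes "f \<in> carrier A" "g \<in> carrier A" "h \<in> carrier A"
  shows "twisted_bracket (f \<oplus> g) h = twisted_bracket f h \<oplus> twisted_bracket g h"
  using assms
  by (simp add: twisted_bracket_antisym[of h] twisted_bracket_add_right twisted_bracket_closed D.M.minus_add)

lemma twisted_bracket_smult_right:
  assumes "k \<in> carrier K" "f \<in> carrier A" "g \<in> carrier A"
  shows "twisted_bracket f (k \<odot> g) = k \<odot> twisted_bracket f g"
proof -
  have "a \<otimes> (k \<odot> b) = k \<odot> (a \<otimes> b)" if "a \<in> carrier A" "b \<in> carrier A" for a b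
    using that assms D.smult_assoc2[of k b a] by (simp add: D.m_comm[of a])
  then show ?thesis using assms
    by (simp add: twisted_bracket_def closed D.pbracket_smult_right D.der_smult X.der_smult
      D.smult_assoc2 D.smult_r_distr D.smult_r_minus D.M.minus_eq)
qed

lemma twisted_bracket_smult_left:
  assumes "k \<in> carrier K" "f \<in> carrier A" "g \<in> carrier A"
  shows "twisted_bracket (k \<odot> f) g = k \<odot> twisted_bracket f g"
  using assms
  by (simp add: twisted_bracket_antisym[of g] twisted_bracket_smult_right twisted_bracket_closed
      D.smult_r_minus)

lemma twisted_bracket_leibniz:
  assumes "f \<in> carrier A" "g \<in> carrier A" "h \<in> carrier A"
  shows "twisted_bracket f (g \<otimes> h) = twisted_bracket f g \<otimes> h \<oplus> g \<otimes> twisted_bracket f h"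
proof -
  have "\<lbrace>f, g\<rbrace> \<in> carrier A" "\<lbrace>f, h\<rbrace> \<in> carrier A" "X f \<in> carrier A" "X g \<in> carrier A" "X h \<in> carrier A"
    "D f \<in> carrier A" "D g \<in> carrier A" "D h \<in> carrier A"
    using assms by (simp_all add: closed)
  with assms show ?thesis
    unfolding twisted_bracket_def D.pbracket_leibniz[OF assms] D.der_mult[OF assms(2,3)] X.der_mult[OF
        assms(2,3)]
    by algebra
qed

lemma twisted_bracket_jacobi:
  assumes "f \<in> carrier A" "g \<in> carrier A" "h \<in> carrier A"
  shows "twisted_bracket f (twisted_bracket g h) = twisted_bracket (twisted_bracket f g) h
      \<oplus> twisted_bracket g (twisted_bracket f h)"
proof -
  let ?p = "twisted_bracket f (twisted_bracket g h)" and ?q = "twisted_bracket g (twisted_bracket f h)"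
    and ?r = "twisted_bracket (twisted_bracket f g) h"
  have cl: "?p \<in> carrier A" "?q \<in> carrier A" "?r \<in> carrier A"
    using assms by (simp_all add: twisted_bracket_closed)
  have neg: "twisted_bracket a (\<ominus> b) = \<ominus> twisted_bracket a b" if "a \<in> carrier A" "b \<in> carrier A" for a b
    using that by (simp add: twisted_bracket_def closed D.pbracket_a_inv_right D.der_a_inv X.der_a_inv
      D.M.minus_eq D.r_minus D.M.minus_add)
  have "twisted_bracket g (twisted_bracket h f) = \<ominus> ?q"
    using assms by (simp add: twisted_bracket_antisym[of f h] neg twisted_bracket_closed)
  moreover have "twisted_bracket h (twisted_bracket f g) = \<ominus> ?r"
    using assms by (intro twisted_bracket_antisym twisted_bracket_closed)
  ultimately have "?p \<oplus> \<ominus> ?q \<oplus> \<ominus> ?r = \<zero>"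
    using twisted_bracket_cyclic[OF assms] by simp
  then have "?r \<oplus> ?q \<oplus> (?p \<oplus> \<ominus> ?q \<oplus> \<ominus> ?r) = ?r \<oplus> ?q"
    using cl by simp
  moreover have "?r \<oplus> ?q \<oplus> (?p \<oplus> \<ominus> ?q \<oplus> \<ominus> ?r) = ?p"
    using cl by algebra
  ultimately show ?thesis by simp
qed

theorem poisson_algebra_twisted:
  assumes br: "\<And>f g. \<lbrakk>f \<in> carrier A; g \<in> carrier A\<rbrakk> \<Longrightarrow> br f g = twisted_bracket f g"
  shows "poisson_algebra K (A\<lparr>pbracket := br\<rparr>)"
proof -
  let ?B = "A\<lparr>pbracket := br\<rparr>"
  have "cring ?B"
    by (rule cring_cong[OF D.cring_axioms]) simp_all
  then have "algebra K ?B"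
    by (intro algebraI) (simp_all add: D.R_cring D.smult_l_distr D.smult_r_distr D.smult_assoc1 D.smult_assoc2)
  then show ?thesis
    by (intro poisson_algebra.intro poisson_algebra_axioms.intro)
      (simp_all add: br twisted_bracket_closed twisted_bracket_add_left twisted_bracket_add_right
        twisted_bracket_smult_left twisted_bracket_smult_right twisted_bracket_self
        twisted_bracket_jacobi[symmetric] twisted_bracket_leibniz)
qed

end

section \<open>Laurent polynomials and convolutions\<close>

text \<open>
  The convolution along a biadditive map: it is determined by biadditivity and its values
  \<open>(a x^i, b x^j) \<mapsto> \<beta>(a, b) x^(i + j)\<close> on monomials. The product of Laurent polynomials and the
  coefficientwise extension of a Poisson bracket are both of this form.
\<close>

definition laurent_conv :: "('a, 'm) ring_scheme \<Rightarrow> ('a \<Rightarrow> 'a \<Rightarrow> 'a) \<Rightarrow> (int \<Rightarrow> 'a) \<Rightarrow> (int \<Rightarrow> 'a) \<Rightarrow> int \<Rightarrow> 'a"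
  where "laurent_conv R b f g = (\<lambda>n. \<Oplus>\<^bsub>R\<^esub>i \<in> laurent_supp R f. b (f i) (g (n - i)))"

lemma laurent_add_apply: "(f \<oplus>\<^bsub>laurent_ring R\<^esub> g) n = f n \<oplus>\<^bsub>R\<^esub> g n"
  by (simp add: laurent_ring_def)

lemma laurent_zero_apply: "\<zero>\<^bsub>laurent_ring R\<^esub> n = \<zero>\<^bsub>R\<^esub>"
  by (simp add: laurent_ring_def)

lemma laurent_mult_conv: "mult (laurent_ring R) = laurent_conv R (mult R)"
  by (simp add: laurent_ring_def laurent_conv_def fun_eq_iff)

lemma laurent_one_monom: "\<one>\<^bsub>laurent_ring R\<^esub> = laurent_monom R \<one>\<^bsub>R\<^esub> 0"
  by (simp add: laurent_ring_def)

lemma laurent_monom_apply: "laurent_monom R a i n = (if n = i then a else \<zero>\<^bsub>R\<^esub>)"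
  by (simp add: laurent_monom_def)

lemma notin_laurent_supp_iff [simp]: "n \<notin> laurent_supp R f \<longleftrightarrow> f n = \<zero>\<^bsub>R\<^esub>"
  by (simp add: laurent_supp_def)

context abelian_group
begin

lemma laurent_carrierI:
  assumes "\<And>n. f n \<in> carrier G" "finite S" "\<And>n. n \<notin> S \<Longrightarrow> f n = \<zero>"
  shows "f \<in> carrier (laurent_ring G)"
proof -
  have "laurent_supp G f \<subseteq> S" using assms(3) by (auto simp: laurent_supp_def)
  then have "finite (laurent_supp G f)" using assms(2) by (rule finite_subset)
  with assms(1) show ?thesis
    by (simp add: laurent_ring_def)
qed

lemma laurent_supp_finite [simp]: "f \<in> carrier (laurent_ring G) \<Longrightarrow> finite (laurent_supp G f)"
  by (simp add: laurent_ring_def)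

lemma laurent_carrierD [simp]: "f \<in> carrier (laurent_ring G) \<Longrightarrow> f n \<in> carrier G"
  unfolding laurent_ring_def by (simp add: Pi_iff)

lemma laurent_monom_closed [simp]: "a \<in> carrier G \<Longrightarrow> laurent_monom G a i \<in> carrier (laurent_ring G)"
  by (rule laurent_carrierI[of _ "{i}"]) (auto simp: laurent_monom_apply)

lemma laurent_add_closed [simp]:
  assumes "f \<in> carrier (laurent_ring G)" "g \<in> carrier (laurent_ring G)"
  shows "f \<oplus>\<^bsub>laurent_ring G\<^esub> g \<in> carrier (laurent_ring G)"
  using assms by (intro laurent_carrierI[of _ "laurent_supp G f \<union> laurent_supp G g"])
    (auto simp: laurent_add_apply)

lemma laurent_zero_closed [simp]: "\<zero>\<^bsub>laurent_ring G\<^esub> \<in> carrier (laurent_ring G)"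
  by (rule laurent_carrierI[of _ "{}"]) (auto simp: laurent_zero_apply)

lemma laurent_abelian_group: "abelian_group (laurent_ring G)"
proof (rule abelian_groupI)
  fix f assume f: "f \<in> carrier (laurent_ring G)"
  then have "(\<lambda>n. \<ominus> f n) \<in> carrier (laurent_ring G)"
    by (intro laurent_carrierI[of _ "laurent_supp G f"]) auto
  moreover have "(\<lambda>n. \<ominus> f n) \<oplus>\<^bsub>laurent_ring G\<^esub> f = \<zero>\<^bsub>laurent_ring G\<^esub>"
    using f by (simp add: fun_eq_iff laurent_add_apply laurent_zero_apply l_neg)
  ultimately show "\<exists>g \<in> carrier (laurent_ring G). g \<oplus>\<^bsub>laurent_ring G\<^esub> f = \<zero>\<^bsub>laurent_ring G\<^esub>"
    by blast
qed (simp_all add: fun_eq_iff laurent_add_apply laurent_zero_apply a_ac)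

lemma laurent_finsum_closed [simp]:
  "(\<And>i. i \<in> S \<Longrightarrow> F i \<in> carrier (laurent_ring G)) \<Longrightarrow>
    (\<Oplus>\<^bsub>laurent_ring G\<^esub>i \<in> S. F i) \<in> carrier (laurent_ring G)"
  by (intro abelian_monoid.finsum_closed abelian_group.axioms(1) laurent_abelian_group) auto

lemma laurent_finsum_insert:
  assumes "finite S" "j \<notin> S" "F \<in> insert j S \<rightarrow> carrier (laurent_ring G)"
  shows "(\<Oplus>\<^bsub>laurent_ring G\<^esub>i \<in> insert j S. F i) = F j \<oplus>\<^bsub>laurent_ring G\<^esub> (\<Oplus>\<^bsub>laurent_ring G\<^esub>i \<in> S. F i)"
  using assms by (intro abelian_monoid.finsum_insert abelian_group.axioms(1) laurent_abelian_group) auto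

lemma laurent_finsum_empty: "(\<Oplus>\<^bsub>laurent_ring G\<^esub>i \<in> {}. F i) = \<zero>\<^bsub>laurent_ring G\<^esub>"
  by (intro abelian_monoid.finsum_empty abelian_group.axioms(1) laurent_abelian_group)

lemma laurent_finsum_apply:
  assumes "finite S" "F \<in> S \<rightarrow> carrier (laurent_ring G)"
  shows "(\<Oplus>\<^bsub>laurent_ring G\<^esub>i \<in> S. F i) n = (\<Oplus>i \<in> S. F i n)"
  using assms
proof (induction S rule: finite_induct)
  case (insert j S)
  then have "(\<lambda>i. F i n) \<in> S \<rightarrow> carrier G" "F j n \<in> carrier G"
    by (auto simp: Pi_def)
  with insert show ?case
    by (simp add: laurent_finsum_insert laurent_add_apply finsum_insert)
qed (simp add: laurent_finsum_empty laurent_zero_apply)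

lemma laurent_expand:
  assumes f: "f \<in> carrier (laurent_ring G)" and S: "finite S" "laurent_supp G f \<subseteq> S"
  shows "(\<Oplus>\<^bsub>laurent_ring G\<^esub>i \<in> S. laurent_monom G (f i) i) = f"
proof
  fix n
  have "(\<Oplus>\<^bsub>laurent_ring G\<^esub>i \<in> S. laurent_monom G (f i) i) n = (\<Oplus>i \<in> S. if n = i then f i else \<zero>)"
    using f S by (simp add: laurent_finsum_apply laurent_monom_apply Pi_def cong: if_cong)
  also have "\<dots> = f n"
  proof (cases "n \<in> S")
    case True
    then show ?thesis using add.finprod_singleton[of n S f] S f by auto
  next
    case False
    then have "(\<Oplus>i \<in> S. if n = i then f i else \<zero>) = (\<Oplus>i \<in> S. \<zero>)"
      by (intro finsum_cong') auto
    also have "\<dots> = f n" using False S by (metis finsum_zero notin_laurent_supp_iff subsetD)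
    finally show ?thesis .
  qed
  finally show "(\<Oplus>\<^bsub>laurent_ring G\<^esub>i \<in> S. laurent_monom G (f i) i) n = f n" .
qed

lemma laurent_zero_monom: "laurent_monom G \<zero> i = \<zero>\<^bsub>laurent_ring G\<^esub>"
  by (simp add: fun_eq_iff laurent_monom_apply laurent_zero_apply)

text \<open>
  Identities between multiadditive expressions in Laurent polynomials are reduced by this rule to
  monomials, one argument at a time.
\<close>

lemma laurent_induct [consumes 1, case_names monom add]:
  assumes f: "f \<in> carrier (laurent_ring G)"
    and monom: "\<And>a i. a \<in> carrier G \<Longrightarrow> P (laurent_monom G a i)"
    and add: "\<And>f g. \<lbrakk>f \<in> carrier (laurent_ring G); g \<in> carrier (laurent_ring G); P f; P g\<rbrakk>
      \<Longrightarrow> P (f \<oplus>\<^bsub>laurent_ring G\<^esub> g)"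
  shows "P f"
proof -
  have "P (\<Oplus>\<^bsub>laurent_ring G\<^esub>i \<in> S. laurent_monom G (f i) i)" if "finite S" for S
    using that
  proof (induction S rule: finite_induct)
    case empty
    then show ?case using monom[of \<zero> 0] by (simp add: laurent_finsum_empty laurent_zero_monom)
  next
    case (insert j S)
    then show ?case using f by (subst laurent_finsum_insert) (auto intro!: add monom)
  qed
  from this[OF laurent_supp_finite[OF f]] show ?thesis
    using laurent_expand[OF f laurent_supp_finite[OF f] order_refl] by simp
qed

end

locale biadditive = abelian_group +
  fixes b :: "'a \<Rightarrow> 'a \<Rightarrow> 'a"
  assumes b_closed: "\<lbrakk>x \<in> carrier G; y \<in> carrier G\<rbrakk> \<Longrightarrow> b x y \<in> carrier G"
    and b_add_left: "\<lbrakk>x \<in> carrier G; y \<in> carrier G; z \<in> carrier G\<rbrakk> \<Longrightarrow> b (x \<oplus> y) z = b x z \<oplus> b y z"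
    and b_add_right: "\<lbrakk>x \<in> carrier G; y \<in> carrier G; z \<in> carrier G\<rbrakk> \<Longrightarrow> b x (y \<oplus> z) = b x y \<oplus> b x z"
begin

lemma b_zero_left: "x \<in> carrier G \<Longrightarrow> b \<zero> x = \<zero>"
  using b_add_left[of \<zero> \<zero> x] b_closed[of \<zero> x] by (simp add: add.l_cancel_one)

lemma b_zero_right: "x \<in> carrier G \<Longrightarrow> b x \<zero> = \<zero>"
  using b_add_right[of x \<zero> \<zero>] b_closed[of x \<zero>] by (simp add: add.l_cancel_one)

text \<open>
  Enlarging the range of summation allows the convolutions of two different left arguments to be
  compared over a common range.
\<close>

lemma conv_superset:
  assumes f: "f \<in> carrier (laurent_ring G)" and g: "g \<in> carrier (laurent_ring G)"
    and S: "finite S" "laurent_supp G f \<subseteq> S"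
  shows "laurent_conv G b f g n = (\<Oplus>i \<in> S. b (f i) (g (n - i)))"
  unfolding laurent_conv_def
  using assms by (intro add.finprod_mono_neutral_cong_left) (auto simp: laurent_supp_def b_closed b_zero_left)

lemma conv_closed:
  assumes f: "f \<in> carrier (laurent_ring G)" and g: "g \<in> carrier (laurent_ring G)"
  shows "laurent_conv G b f g \<in> carrier (laurent_ring G)"
proof (rule laurent_carrierI)
  show "laurent_conv G b f g n \<in> carrier G" for n
    unfolding laurent_conv_def using f g by (auto intro!: finsum_closed b_closed)
  show "finite ((\<lambda>(i, j). i + j) ` (laurent_supp G f \<times> laurent_supp G g))"
    using f g by simp
  fix n assume n: "n \<notin> (\<lambda>(i, j). i + j) ` (laurent_supp G f \<times> laurent_supp G g)"
  have "g (n - i) = \<zero>" if "i \<in> laurent_supp G f" for i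
  proof (rule ccontr)
    assume "g (n - i) \<noteq> \<zero>"
    then have "(i, n - i) \<in> laurent_supp G f \<times> laurent_supp G g"
      using that by (simp add: laurent_supp_def)
    then show False using n by force
  qed
  then show "laurent_conv G b f g n = \<zero>"
    unfolding laurent_conv_def using f by (auto intro!: add.finprod_one_eqI b_zero_right)
qed

lemma conv_add_left:
  assumes "f \<in> carrier (laurent_ring G)" "g \<in> carrier (laurent_ring G)" "h \<in> carrier (laurent_ring G)"
  shows "laurent_conv G b (f \<oplus>\<^bsub>laurent_ring G\<^esub> g) h
    = laurent_conv G b f h \<oplus>\<^bsub>laurent_ring G\<^esub> laurent_conv G b g h"
proof
  fix n
  let ?S = "laurent_supp G f \<union> laurent_supp G g"
  have "laurent_supp G (f \<oplus>\<^bsub>laurent_ring G\<^esub> g) \<subseteq> ?S"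
    using assms by (auto simp: laurent_supp_def laurent_add_apply)
  then show "laurent_conv G b (f \<oplus>\<^bsub>laurent_ring G\<^esub> g) h n
    = (laurent_conv G b f h \<oplus>\<^bsub>laurent_ring G\<^esub> laurent_conv G b g h) n"
    using assms by (simp add: conv_superset[where S = ?S] laurent_add_apply b_add_left b_closed finsum_addf
        Pi_def)
qed

lemma conv_add_right:
  assumes "f \<in> carrier (laurent_ring G)" "g \<in> carrier (laurent_ring G)" "h \<in> carrier (laurent_ring G)"
  shows "laurent_conv G b f (g \<oplus>\<^bsub>laurent_ring G\<^esub> h)
    = laurent_conv G b f g \<oplus>\<^bsub>laurent_ring G\<^esub> laurent_conv G b f h"
  using assms by (simp add: fun_eq_iff laurent_conv_def laurent_add_apply b_add_right b_closed finsum_addf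
      Pi_def)

lemma conv_monom_left:
  assumes "a \<in> carrier G" "g \<in> carrier (laurent_ring G)"
  shows "laurent_conv G b (laurent_monom G a i) g n = b a (g (n - i))"
  using assms
  by (subst conv_superset[where S = "{i}"])
    (auto simp: laurent_supp_def laurent_monom_apply b_closed)

lemma conv_monom:
  assumes "x \<in> carrier G" "y \<in> carrier G"
  shows "laurent_conv G b (laurent_monom G x i) (laurent_monom G y j) = laurent_monom G (b x y) (i + j)"
  using assms by (auto simp: fun_eq_iff conv_monom_left laurent_monom_apply b_zero_right)

end

lemma (in ring) biadditive_mult: "biadditive R (mult R)"
  by unfold_locales (simp_all add: l_distr r_distr)

lemma (in cring) laurent_cring: "cring (laurent_ring R)"
proof -
  interpret m: biadditive R "mult R" by (rule biadditive_mult)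
  note simps = laurent_mult_conv laurent_one_monom m.conv_closed m.conv_add_left m.conv_add_right m.conv_monom
  let ?L = "laurent_ring R"
  have "comm_monoid ?L"
  proof (rule comm_monoidI)
    fix f g assume f: "f \<in> carrier ?L" and g: "g \<in> carrier ?L"
    show "f \<otimes>\<^bsub>?L\<^esub> g \<in> carrier ?L"
      using f g by (simp add: simps)
    show "f \<otimes>\<^bsub>?L\<^esub> g = g \<otimes>\<^bsub>?L\<^esub> f" using f
    proof (induction f rule: laurent_induct)
      case (monom a i)
      show ?case using g monom
        by (induction g rule: laurent_induct) (simp_all add: simps m_comm add.commute)
    qed (use g in \<open>simp add: simps\<close>)
    fix h assume h: "h \<in> carrier ?L"
    show "f \<otimes>\<^bsub>?L\<^esub> g \<otimes>\<^bsub>?L\<^esub> h = f \<otimes>\<^bsub>?L\<^esub> (g \<otimes>\<^bsub>?L\<^esub> h)" using f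
    proof (induction f rule: laurent_induct)
      case (monom a i)
      show ?case using g
      proof (induction g rule: laurent_induct)
        case (monom c j)
        show ?case using h monom \<open>a \<in> carrier R\<close>
          by (induction h rule: laurent_induct) (simp_all add: simps m_assoc add.assoc)
      qed (use h monom in \<open>simp add: simps\<close>)
    qed (use g h in \<open>simp add: simps\<close>)
  next
    fix f assume "f \<in> carrier ?L"
    then show "\<one>\<^bsub>?L\<^esub> \<otimes>\<^bsub>?L\<^esub> f = f"
      by (simp add: fun_eq_iff simps m.conv_monom_left)
  qed (simp add: simps)
  then show ?thesis
    by (intro cringI laurent_abelian_group) (simp_all add: simps)
qed

section \<open>The coefficientwise Poisson bracket on Laurent polynomials\<close>

text \<open>
  The Laurent polynomial algebra with \<open>x\<close> a Casimir element, that is, the case \<open>\<alpha> = \<delta> = 0\<close>. All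
  Ore brackets are twists of this one.
\<close>

definition laurent_poisson :: "('k, 'a, 'm) poisson_scheme \<Rightarrow> ('k, int \<Rightarrow> 'a) poisson"
  where "laurent_poisson A = \<lparr>
    carrier = carrier (laurent_ring A),
    mult = mult (laurent_ring A),
    one = one (laurent_ring A),
    zero = zero (laurent_ring A),
    add = add (laurent_ring A),
    smult = (\<lambda>k f i. k \<odot>\<^bsub>A\<^esub> f i),
    pbracket = laurent_conv A (pbracket A)\<rparr>"

text \<open>
  The derivation \<open>x d/dx\<close>.
\<close>

definition laurent_euler :: "('a, 'm) ring_scheme \<Rightarrow> (int \<Rightarrow> 'a) \<Rightarrow> int \<Rightarrow> 'a"
  where "laurent_euler R f = (\<lambda>n. [n] \<cdot>\<^bsub>R\<^esub> f n)"

text \<open>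
  The coefficientwise application of \<open>d\<close> followed by the multiplication with \<open>x^(-s)\<close>; it is again a
  derivation when \<open>d\<close> is one.
\<close>

definition laurent_map :: "('a \<Rightarrow> 'a) \<Rightarrow> int \<Rightarrow> (int \<Rightarrow> 'a) \<Rightarrow> int \<Rightarrow> 'a"
  where "laurent_map d s f = (\<lambda>n. d (f (n + s)))"

context poisson_algebra
begin

abbreviation (input) "B \<equiv> laurent_poisson A"

lemma biadditive_pbracket: "biadditive A (pbracket A)"
  by unfold_locales (simp_all add: pbracket_closed pbracket_add_left pbracket_add_right)

lemma laurent_poisson_cring: "cring B"
  by (rule cring_cong[OF laurent_cring]) (simp_all add: laurent_poisson_def)

lemma laurent_poisson_add_apply: "(f \<oplus>\<^bsub>B\<^esub> g) n = f n \<oplus> g n"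
  by (simp add: laurent_poisson_def laurent_add_apply)

lemma laurent_poisson_zero_apply: "\<zero>\<^bsub>B\<^esub> n = \<zero>"
  by (simp add: laurent_poisson_def laurent_zero_apply)

lemma laurent_poisson_smult_apply: "(k \<odot>\<^bsub>B\<^esub> f) n = k \<odot> f n"
  by (simp add: laurent_poisson_def)

lemma laurent_poisson_apply_closed: "f \<in> carrier B \<Longrightarrow> f n \<in> carrier A"
  by (simp add: laurent_poisson_def)

lemma laurent_poisson_carrierI:
  assumes "\<And>n. f n \<in> carrier A" "finite S" "\<And>n. n \<notin> S \<Longrightarrow> f n = \<zero>"
  shows "f \<in> carrier B"
  using M.laurent_carrierI[OF assms] by (simp add: laurent_poisson_def)

lemma laurent_poisson_induct [consumes 1, case_names monom add]:
  assumes "f \<in> carrier B"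
    and "\<And>a i. a \<in> carrier A \<Longrightarrow> P (laurent_monom A a i)"
    and "\<And>f g. \<lbrakk>f \<in> carrier B; g \<in> carrier B; P f; P g\<rbrakk> \<Longrightarrow> P (f \<oplus>\<^bsub>B\<^esub> g)"
  shows "P f"
  using assms M.laurent_induct[of f P] by (simp add: laurent_poisson_def)

lemma laurent_poisson_monom_closed: "a \<in> carrier A \<Longrightarrow> laurent_monom A a i \<in> carrier B"
  by (simp add: laurent_poisson_def)

lemma laurent_poisson_monom_add:
  "\<lbrakk>a \<in> carrier A; b \<in> carrier A\<rbrakk> \<Longrightarrow> laurent_monom A a i \<oplus>\<^bsub>B\<^esub> laurent_monom A b i = laurent_monom A (a \<oplus> b) i"
  by (simp add: fun_eq_iff laurent_poisson_add_apply laurent_monom_apply)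

lemma laurent_poisson_monom_zero: "laurent_monom A \<zero> i = \<zero>\<^bsub>B\<^esub>"
  by (simp add: fun_eq_iff laurent_poisson_zero_apply laurent_monom_apply)

lemma laurent_poisson_monom_mult:
  "\<lbrakk>a \<in> carrier A; b \<in> carrier A\<rbrakk> \<Longrightarrow> laurent_monom A a i \<otimes>\<^bsub>B\<^esub> laurent_monom A b j
      = laurent_monom A (a \<otimes> b) (i + j)"
  by (simp add: laurent_poisson_def laurent_mult_conv biadditive.conv_monom[OF biadditive_mult])

lemma laurent_poisson_monom_pbracket:
  "\<lbrakk>a \<in> carrier A; b \<in> carrier A\<rbrakk> \<Longrightarrow> \<lbrace>laurent_monom A a i, laurent_monom A b j\<rbrace>\<^bsub>B\<^esub>
      = laurent_monom A \<lbrace>a, b\<rbrace> (i + j)"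
  by (simp add: laurent_poisson_def biadditive.conv_monom[OF biadditive_pbracket])

lemma laurent_poisson_monom_smult:
  "k \<in> carrier K \<Longrightarrow> k \<odot>\<^bsub>B\<^esub> laurent_monom A a i = laurent_monom A (k \<odot> a) i"
  by (simp add: fun_eq_iff laurent_poisson_smult_apply laurent_monom_apply)

lemma laurent_poisson_smult_closed:
  assumes "k \<in> carrier K" "f \<in> carrier B"
  shows "k \<odot>\<^bsub>B\<^esub> f \<in> carrier B"
proof (rule laurent_poisson_carrierI)
  show "finite (laurent_supp A f)"
    using assms by (simp add: laurent_poisson_def)
qed (use assms in \<open>simp_all add: laurent_poisson_smult_apply laurent_poisson_apply_closed\<close>)

lemma laurent_poisson_pbracket_closed: "\<lbrakk>f \<in> carrier B; g \<in> carrier B\<rbrakk> \<Longrightarrow> \<lbrace>f, g\<rbrace>\<^bsub>B\<^esub> \<in> carrier B"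
  by (simp add: laurent_poisson_def biadditive.conv_closed[OF biadditive_pbracket])

lemma laurent_poisson_pbracket_add:
  assumes "f \<in> carrier B" "g \<in> carrier B" "h \<in> carrier B"
  shows "\<lbrace>f \<oplus>\<^bsub>B\<^esub> g, h\<rbrace>\<^bsub>B\<^esub> = \<lbrace>f, h\<rbrace>\<^bsub>B\<^esub> \<oplus>\<^bsub>B\<^esub> \<lbrace>g, h\<rbrace>\<^bsub>B\<^esub>"
    and "\<lbrace>h, f \<oplus>\<^bsub>B\<^esub> g\<rbrace>\<^bsub>B\<^esub> = \<lbrace>h, f\<rbrace>\<^bsub>B\<^esub> \<oplus>\<^bsub>B\<^esub> \<lbrace>h, g\<rbrace>\<^bsub>B\<^esub>"
  using assms biadditive.conv_add_left[OF biadditive_pbracket, of f g h]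
    biadditive.conv_add_right[OF biadditive_pbracket, of h f g]
  by (simp_all add: laurent_poisson_def)

lemma laurent_poisson_algebra: "algebra K B"
proof (rule algebraI[OF R_cring laurent_poisson_cring])
  interpret B: cring B by (rule laurent_poisson_cring)
  fix k f g assume k: "k \<in> carrier K" and f: "f \<in> carrier B" and g: "g \<in> carrier B"
  have add: "k \<odot>\<^bsub>B\<^esub> (p \<oplus>\<^bsub>B\<^esub> q) = k \<odot>\<^bsub>B\<^esub> p \<oplus>\<^bsub>B\<^esub> k \<odot>\<^bsub>B\<^esub> q"
    if "p \<in> carrier B" "q \<in> carrier B" for p q
    using that k by (simp add: fun_eq_iff laurent_poisson_smult_apply laurent_poisson_add_apply
        laurent_poisson_apply_closed smult_r_distr)
  show "k \<odot>\<^bsub>B\<^esub> (f \<oplus>\<^bsub>B\<^esub> g) = k \<odot>\<^bsub>B\<^esub> f \<oplus>\<^bsub>B\<^esub> k \<odot>\<^bsub>B\<^esub> g"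
    using f g by (rule add)
  show "k \<odot>\<^bsub>B\<^esub> f \<in> carrier B"
    using k f by (rule laurent_poisson_smult_closed)
  show "k \<odot>\<^bsub>B\<^esub> f \<otimes>\<^bsub>B\<^esub> g = k \<odot>\<^bsub>B\<^esub> (f \<otimes>\<^bsub>B\<^esub> g)"
    using f
  proof (induction f rule: laurent_poisson_induct)
    case (monom a i)
    show ?case using g monom k
      by (induction g rule: laurent_poisson_induct)
        (simp_all add: add B.r_distr laurent_poisson_smult_closed laurent_poisson_monom_closed
            laurent_poisson_monom_smult laurent_poisson_monom_mult smult_assoc2)
  qed (use g k in \<open>simp add: add B.l_distr laurent_poisson_smult_closed\<close>)
qed (simp_all add: fun_eq_iff laurent_poisson_smult_apply laurent_poisson_add_apply
    laurent_poisson_apply_closed smult_l_distr smult_assoc1)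

lemma laurent_poisson_poisson_algebra: "poisson_algebra K B"
proof (intro poisson_algebra.intro poisson_algebra_axioms.intro laurent_poisson_algebra)
  interpret B: algebra K B by (rule laurent_poisson_algebra)
  note closed = laurent_poisson_monom_closed laurent_poisson_pbracket_closed
  note additive = laurent_poisson_pbracket_add B.smult_r_distr B.r_distr B.l_distr
  note monomial = laurent_poisson_monom_pbracket laurent_poisson_monom_mult laurent_poisson_monom_smult
      laurent_poisson_monom_add pbracket_closed
  have zero: "\<lbrace>f, g\<rbrace>\<^bsub>B\<^esub> \<oplus>\<^bsub>B\<^esub> \<lbrace>g, f\<rbrace>\<^bsub>B\<^esub> = \<zero>\<^bsub>B\<^esub>" if "f \<in> carrier B" "g \<in> carrier B" for f g
    using that
  proof (induction f rule: laurent_poisson_induct)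
    case (monom a i)
    show ?case using \<open>g \<in> carrier B\<close> monom
    proof (induction g rule: laurent_poisson_induct)
      case (monom b j)
      then show ?case
        by (simp add: monomial add.commute[of j] pbracket_antisym[of a b] M.r_neg laurent_poisson_monom_zero)
    next
      case (add g h)
      have "\<lbrace>laurent_monom A a i, g \<oplus>\<^bsub>B\<^esub> h\<rbrace>\<^bsub>B\<^esub> \<oplus>\<^bsub>B\<^esub> \<lbrace>g \<oplus>\<^bsub>B\<^esub> h, laurent_monom A a i\<rbrace>\<^bsub>B\<^esub>
        = (\<lbrace>laurent_monom A a i, g\<rbrace>\<^bsub>B\<^esub> \<oplus>\<^bsub>B\<^esub> \<lbrace>g, laurent_monom A a i\<rbrace>\<^bsub>B\<^esub>)
          \<oplus>\<^bsub>B\<^esub> (\<lbrace>laurent_monom A a i, h\<rbrace>\<^bsub>B\<^esub> \<oplus>\<^bsub>B\<^esub> \<lbrace>h, laurent_monom A a i\<rbrace>\<^bsub>B\<^esub>)"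
        using add(1,2,5) by (simp add: additive closed B.M.a_ac)
      then show ?case using add by simp
    qed
  next
    case (add f h)
    have "\<lbrace>f \<oplus>\<^bsub>B\<^esub> h, g\<rbrace>\<^bsub>B\<^esub> \<oplus>\<^bsub>B\<^esub> \<lbrace>g, f \<oplus>\<^bsub>B\<^esub> h\<rbrace>\<^bsub>B\<^esub>
      = (\<lbrace>f, g\<rbrace>\<^bsub>B\<^esub> \<oplus>\<^bsub>B\<^esub> \<lbrace>g, f\<rbrace>\<^bsub>B\<^esub>) \<oplus>\<^bsub>B\<^esub> (\<lbrace>h, g\<rbrace>\<^bsub>B\<^esub> \<oplus>\<^bsub>B\<^esub> \<lbrace>g, h\<rbrace>\<^bsub>B\<^esub>)"
      using add(1,2,5) by (simp add: additive closed B.M.a_ac)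
    then show ?case using add by simp
  qed
  fix f assume f: "f \<in> carrier B"
  show "\<lbrace>f, f\<rbrace>\<^bsub>B\<^esub> = \<zero>\<^bsub>B\<^esub>"
    using f
  proof (induction f rule: laurent_poisson_induct)
    case (monom a i)
    then show ?case by (simp add: monomial pbracket_self laurent_poisson_monom_zero)
  next
    case (add f g)
    then show ?case using zero[of f g] zero[of g f] by (simp add: additive closed)
  qed
  fix g assume g: "g \<in> carrier B"
  show "\<lbrace>f, g\<rbrace>\<^bsub>B\<^esub> \<in> carrier B"
    using f g by (rule laurent_poisson_pbracket_closed)
  {
    fix k assume k: "k \<in> carrier K"
    show "\<lbrace>k \<odot>\<^bsub>B\<^esub> f, g\<rbrace>\<^bsub>B\<^esub> = k \<odot>\<^bsub>B\<^esub> \<lbrace>f, g\<rbrace>\<^bsub>B\<^esub>"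
      using f
    proof (induction f rule: laurent_poisson_induct)
      case (monom a i)
      show ?case using g monom k
        by (induction g rule: laurent_poisson_induct) (simp_all add: additive closed monomial
            pbracket_smult_left)
    qed (use g k in \<open>simp add: additive closed\<close>)
    show "\<lbrace>f, k \<odot>\<^bsub>B\<^esub> g\<rbrace>\<^bsub>B\<^esub> = k \<odot>\<^bsub>B\<^esub> \<lbrace>f, g\<rbrace>\<^bsub>B\<^esub>"
      using f
    proof (induction f rule: laurent_poisson_induct)
      case (monom a i)
      show ?case using g monom k
        by (induction g rule: laurent_poisson_induct) (simp_all add: additive closed monomial
            pbracket_smult_right)
    qed (use g k in \<open>simp add: additive closed\<close>)
  }
  fix h assume h: "h \<in> carrier B"
  show "\<lbrace>f \<oplus>\<^bsub>B\<^esub> g, h\<rbrace>\<^bsub>B\<^esub> = \<lbrace>f, h\<rbrace>\<^bsub>B\<^esub> \<oplus>\<^bsub>B\<^esub> \<lbrace>g, h\<rbrace>\<^bsub>B\<^esub>" "\<lbrace>f, g \<oplus>\<^bsub>B\<^esub> h\<rbrace>\<^bsub>B\<^esub> = \<lbrace>f, g\<rbrace>\<^bsub>B\<^esub> \<oplus>\<^bsub>B\<^esub> \<lbrace>f, h\<rbrace>\<^bsub>B\<^esub>"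
    using f g h by (simp_all add: additive)
  show "\<lbrace>f, \<lbrace>g, h\<rbrace>\<^bsub>B\<^esub>\<rbrace>\<^bsub>B\<^esub> = \<lbrace>\<lbrace>f, g\<rbrace>\<^bsub>B\<^esub>, h\<rbrace>\<^bsub>B\<^esub> \<oplus>\<^bsub>B\<^esub> \<lbrace>g, \<lbrace>f, h\<rbrace>\<^bsub>B\<^esub>\<rbrace>\<^bsub>B\<^esub>"
    using f
  proof (induction f rule: laurent_poisson_induct)
    case (monom a i)
    then have a: "a \<in> carrier A" .
    show ?case using g
    proof (induction g rule: laurent_poisson_induct)
      case (monom b j)
      then have b: "b \<in> carrier A" .
      show ?case using h
      proof (induction h rule: laurent_poisson_induct)
        case (monom c l)
        with a b show ?case
          by (simp add: monomial pbracket_jacobi[of a b c] add.assoc add.left_commute[of j])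
      qed (use a b in \<open>simp add: additive closed B.M.a_ac\<close>)
    qed (use a h in \<open>simp add: additive closed B.M.a_ac\<close>)
  qed (use g h in \<open>simp add: additive closed B.M.a_ac\<close>)
  show "\<lbrace>f, g \<otimes>\<^bsub>B\<^esub> h\<rbrace>\<^bsub>B\<^esub> = \<lbrace>f, g\<rbrace>\<^bsub>B\<^esub> \<otimes>\<^bsub>B\<^esub> h \<oplus>\<^bsub>B\<^esub> g \<otimes>\<^bsub>B\<^esub> \<lbrace>f, h\<rbrace>\<^bsub>B\<^esub>"
    using f
  proof (induction f rule: laurent_poisson_induct)
    case (monom a i)
    then have a: "a \<in> carrier A" .
    show ?case using g
    proof (induction g rule: laurent_poisson_induct)
      case (monom b j)
      then have b: "b \<in> carrier A" .
      show ?case using h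
      proof (induction h rule: laurent_poisson_induct)
        case (monom c l)
        with a b show ?case
          by (simp add: monomial pbracket_leibniz add.assoc add.left_commute[of j])
      qed (use a b in \<open>simp add: additive closed B.M.a_ac\<close>)
    qed (use a h in \<open>simp add: additive closed B.M.a_ac\<close>)
  qed (use g h in \<open>simp add: additive closed B.M.a_ac\<close>)
qed

end

section \<open>The derivations behind the Ore bracket\<close>

context poisson_algebra
begin

lemma pbracket_add_pow_left:
  "\<lbrakk>a \<in> carrier A; b \<in> carrier A\<rbrakk> \<Longrightarrow> \<lbrace>[(n :: int)] \<cdot> a, b\<rbrace> = [n] \<cdot> \<lbrace>a, b\<rbrace>"
  by (rule additive_add_pow[OF M.abelian_group_axioms M.abelian_group_axioms, where h = "\<lambda>a. \<lbrace>a, b\<rbrace>"])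
    (simp_all add: pbracket_add_left pbracket_closed)

lemma pbracket_add_pow_right:
  "\<lbrakk>a \<in> carrier A; b \<in> carrier A\<rbrakk> \<Longrightarrow> \<lbrace>a, [(n :: int)] \<cdot> b\<rbrace> = [n] \<cdot> \<lbrace>a, b\<rbrace>"
  by (rule additive_add_pow[OF M.abelian_group_axioms M.abelian_group_axioms, where h = "\<lambda>b. \<lbrace>a, b\<rbrace>"])
    (simp_all add: pbracket_add_right pbracket_closed)

lemma laurent_poisson_minus_apply:
  assumes "f \<in> carrier B" "g \<in> carrier B"
  shows "(f \<ominus>\<^bsub>B\<^esub> g) n = f n \<ominus> g n"
proof -
  interpret B: cring B by (rule laurent_poisson_cring)
  have "(f \<ominus>\<^bsub>B\<^esub> g) \<oplus>\<^bsub>B\<^esub> g = f"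
    using assms by algebra
  then have "(f \<ominus>\<^bsub>B\<^esub> g) n \<oplus> g n = f n"
    by (metis laurent_poisson_add_apply)
  moreover have "(f \<ominus>\<^bsub>B\<^esub> g) n \<in> carrier A" "g n \<in> carrier A"
    using assms by (simp_all add: laurent_poisson_apply_closed)
  ultimately show ?thesis
    by (metis M.add.inv_solve_right M.a_closed a_minus_def)
qed

lemma laurent_poisson_monom_minus:
  "\<lbrakk>a \<in> carrier A; b \<in> carrier A\<rbrakk> \<Longrightarrow> laurent_monom A (a \<ominus> b) i = laurent_monom A a i \<ominus>\<^bsub>B\<^esub> laurent_monom A b i"
  by (simp add: fun_eq_iff laurent_poisson_minus_apply laurent_poisson_monom_closed laurent_monom_apply
      M.minus_eq)

lemma laurent_poisson_finsum: "finsum (laurent_ring A) F S = finsum B F S"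
  by (simp add: finsum_def finprod_def laurent_poisson_def)

lemma laurent_map_monom:
  "derivation K A d \<Longrightarrow> laurent_map d s (laurent_monom A a i) = laurent_monom A (d a) (i - s)"
  by (auto simp: fun_eq_iff laurent_map_def laurent_monom_apply derivation.der_zero)

lemma derivation_laurent_map:
  assumes "derivation K A d"
  shows "derivation K B (laurent_map d s)"
proof (intro derivation.intro derivation_axioms.intro laurent_poisson_algebra)
  interpret d: derivation K A d by fact
  interpret B: cring B by (rule laurent_poisson_cring)
  have closed: "laurent_map d s f \<in> carrier B" if "f \<in> carrier B" for f
  proof (rule laurent_poisson_carrierI[of _ "(\<lambda>i. i - s) ` laurent_supp A f"])
    show "laurent_map d s f n = \<zero>" if "n \<notin> (\<lambda>i. i - s) ` laurent_supp A f" for n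
    proof -
      have "n + s \<notin> laurent_supp A f" using that by force
      then show ?thesis by (simp add: laurent_map_def d.der_zero)
    qed
  qed (use that in \<open>simp_all add: laurent_map_def d.der_closed laurent_poisson_apply_closed
      laurent_poisson_def\<close>)
  have add: "laurent_map d s (f \<oplus>\<^bsub>B\<^esub> g) = laurent_map d s f \<oplus>\<^bsub>B\<^esub> laurent_map d s g"
    if "f \<in> carrier B" "g \<in> carrier B" for f g
    using that by (simp add: fun_eq_iff laurent_map_def laurent_poisson_add_apply laurent_poisson_apply_closed
        d.der_add)
  fix f g assume f: "f \<in> carrier B" and g: "g \<in> carrier B"
  show "laurent_map d s f \<in> carrier B" using f by (rule closed)
  show "laurent_map d s (f \<oplus>\<^bsub>B\<^esub> g) = laurent_map d s f \<oplus>\<^bsub>B\<^esub> laurent_map d s g" using f g by (rule add)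
  show "laurent_map d s (f \<otimes>\<^bsub>B\<^esub> g) = laurent_map d s f \<otimes>\<^bsub>B\<^esub> g \<oplus>\<^bsub>B\<^esub> f \<otimes>\<^bsub>B\<^esub> laurent_map d s g"
    using f
  proof (induction f rule: laurent_poisson_induct)
    case (monom a i)
    show ?case using g monom
      by (induction g rule: laurent_poisson_induct)
        (simp_all add: add closed laurent_poisson_monom_closed laurent_poisson_monom_mult laurent_map_monom[OF
            assms] d.der_mult d.der_closed
          laurent_poisson_monom_add[symmetric] B.r_distr B.l_distr B.a_ac algebra_simps)
  qed (use g in \<open>simp add: add closed B.r_distr B.l_distr B.a_ac\<close>)
qed (use assms in \<open>simp_all add: fun_eq_iff laurent_map_def laurent_poisson_smult_apply
    laurent_poisson_apply_closed derivation.der_smult\<close>)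

lemma laurent_euler_monom: "laurent_euler A (laurent_monom A a i) = laurent_monom A ([i] \<cdot> a) i"
  by (simp add: fun_eq_iff laurent_euler_def laurent_monom_apply)

lemma poisson_derivation_laurent_euler: "poisson_derivation K B (laurent_euler A)"
proof -
  interpret B: poisson_algebra K B by (rule laurent_poisson_poisson_algebra)
  let ?D = "laurent_euler A"
  have closed: "?D f \<in> carrier B" if "f \<in> carrier B" for f
    by (rule laurent_poisson_carrierI[of _ "laurent_supp A f"])
      (use that in \<open>simp_all add: laurent_euler_def laurent_poisson_apply_closed laurent_poisson_def\<close>)
  have add: "?D (f \<oplus>\<^bsub>B\<^esub> g) = ?D f \<oplus>\<^bsub>B\<^esub> ?D g" if "f \<in> carrier B" "g \<in> carrier B" for f g
    using that by (simp add: fun_eq_iff laurent_euler_def laurent_poisson_add_apply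
        laurent_poisson_apply_closed M.add.int_pow_distrib)
  have smult: "?D (k \<odot>\<^bsub>B\<^esub> f) = k \<odot>\<^bsub>B\<^esub> ?D f" if "k \<in> carrier K" "f \<in> carrier B" for k f
    using that additive_add_pow[OF M.abelian_group_axioms M.abelian_group_axioms, where h = "\<lambda>a. k \<odot> a"]
    by (simp add: fun_eq_iff laurent_euler_def laurent_poisson_smult_apply laurent_poisson_apply_closed
        smult_r_distr)
  have mult: "?D (f \<otimes>\<^bsub>B\<^esub> g) = ?D f \<otimes>\<^bsub>B\<^esub> g \<oplus>\<^bsub>B\<^esub> f \<otimes>\<^bsub>B\<^esub> ?D g"
    and pbracket: "?D \<lbrace>f, g\<rbrace>\<^bsub>B\<^esub> = \<lbrace>?D f, g\<rbrace>\<^bsub>B\<^esub> \<oplus>\<^bsub>B\<^esub> \<lbrace>f, ?D g\<rbrace>\<^bsub>B\<^esub>" if f: "f \<in> carrier B" and g: "g \<in> carrier B" for f g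
  proof -
    show "?D (f \<otimes>\<^bsub>B\<^esub> g) = ?D f \<otimes>\<^bsub>B\<^esub> g \<oplus>\<^bsub>B\<^esub> f \<otimes>\<^bsub>B\<^esub> ?D g"
      using f
    proof (induction f rule: laurent_poisson_induct)
      case (monom a i)
      show ?case using g monom
        by (induction g rule: laurent_poisson_induct)
          (simp_all add: add closed laurent_poisson_monom_closed laurent_poisson_monom_mult
              laurent_poisson_monom_add laurent_euler_monom
            M.add.int_pow_mult add_pow_ldistr_int add_pow_rdistr_int B.r_distr B.l_distr B.M.a_ac M.a_comm)
    qed (use g in \<open>simp add: add closed B.r_distr B.l_distr B.M.a_ac\<close>)
    show "?D \<lbrace>f, g\<rbrace>\<^bsub>B\<^esub> = \<lbrace>?D f, g\<rbrace>\<^bsub>B\<^esub> \<oplus>\<^bsub>B\<^esub> \<lbrace>f, ?D g\<rbrace>\<^bsub>B\<^esub>"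
      using f
    proof (induction f rule: laurent_poisson_induct)
      case (monom a i)
      show ?case using g monom
        by (induction g rule: laurent_poisson_induct)
          (simp_all add: add closed laurent_poisson_monom_closed laurent_poisson_monom_pbracket
              laurent_poisson_monom_add laurent_euler_monom laurent_poisson_pbracket_closed
            pbracket_closed M.add.int_pow_mult pbracket_add_pow_left pbracket_add_pow_right
                laurent_poisson_pbracket_add B.M.a_ac M.a_comm)
    qed (use g in \<open>simp add: add closed laurent_poisson_pbracket_closed laurent_poisson_pbracket_add B.M.a_ac\<close>)
  qed
  show ?thesis
    by (intro poisson_derivation.intro derivation.intro derivation_axioms.intro poisson_derivation_axioms.intro
        laurent_poisson_algebra laurent_poisson_poisson_algebra) (simp_all add: closed add smult mult pbracket)
qed

end

context poisson_pair
begin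

text \<open>
  The derivation \<open>\<alpha> + x^(-1) \<delta>\<close>. The defining relation \<open>{a, x} = \<alpha>(a) x + \<delta>(a)\<close> says that
  \<open>{a, f} = {a, f}\<^sub>0 + (\<alpha>(a) + x^(-1) \<delta>(a)) x df/dx\<close>, where \<open>{\<cdot>, \<cdot>}\<^sub>0\<close> is the bracket
  with \<open>x\<close> a Casimir element; so the Ore bracket is the twist of the latter by this derivation and the
  Euler derivation.
\<close>

definition "ore_derivation f = laurent_map \<alpha> 0 f \<oplus>\<^bsub>B\<^esub> laurent_map \<delta> 1 f"

lemma ore_derivation_monom:
  "ore_derivation (laurent_monom A a i) = laurent_monom A (\<alpha> a) i \<oplus>\<^bsub>B\<^esub> laurent_monom A (\<delta> a) (i - 1)"
  by (simp add: ore_derivation_def laurent_map_monom derivation_axioms \<delta>.derivation_axioms)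

lemma derivation_add:
  assumes "derivation K R d" "derivation K R e"
  shows "derivation K R (\<lambda>f. d f \<oplus>\<^bsub>R\<^esub> e f)"
proof -
  interpret d: derivation K R d by fact
  interpret e: derivation K R e by fact
  show ?thesis
    by unfold_locales
      (simp_all add: d.der_closed e.der_closed d.der_add e.der_add d.der_smult e.der_smult d.der_mult e.der_mult
        d.smult_r_distr d.r_distr d.l_distr d.M.a_ac)
qed

lemma derivation_ore_derivation: "derivation K B ore_derivation"
  unfolding ore_derivation_def[abs_def]
  by (intro derivation_add derivation_laurent_map derivation_axioms \<delta>.derivation_axioms)

lemma \<delta>_pbracket:
  assumes "a \<in> carrier A" "b \<in> carrier A"
  shows "\<delta> \<lbrace>a, b\<rbrace> = (\<lbrace>\<delta> a, b\<rbrace> \<oplus> \<lbrace>a, \<delta> b\<rbrace>) \<oplus> (\<delta> a \<otimes> \<alpha> b \<ominus> \<alpha> a \<otimes> \<delta> b)"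
proof -
  have "\<delta> \<lbrace>a, b\<rbrace> \<in> carrier A" "\<lbrace>\<delta> a, b\<rbrace> \<in> carrier A" "\<lbrace>a, \<delta> b\<rbrace> \<in> carrier A"
    using assms by (simp_all add: \<delta>.der_closed pbracket_closed)
  then show ?thesis
    unfolding pair_identity[OF assms, symmetric] by algebra
qed

text \<open>
  Only \<open>\<delta>\<close> fails to preserve the bracket, by the term \<open>\<delta> \<and> \<alpha>\<close> that the definition of a
  Poisson-pair prescribes. Since \<open>\<alpha> \<and> \<alpha> = 0\<close>, the whole Ore derivation may stand for \<open>x^(-1) \<delta>\<close> in
  this term.
\<close>

lemma ore_derivation_pbracket:
  assumes "f \<in> carrier B" "g \<in> carrier B"
  shows "ore_derivation \<lbrace>f, g\<rbrace>\<^bsub>B\<^esub> = (\<lbrace>ore_derivation f, g\<rbrace>\<^bsub>B\<^esub> \<oplus>\<^bsub>B\<^esub> \<lbrace>f, ore_derivation g\<rbrace>\<^bsub>B\<^esub>)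
    \<oplus>\<^bsub>B\<^esub> (ore_derivation f \<otimes>\<^bsub>B\<^esub> laurent_map \<alpha> 0 g \<ominus>\<^bsub>B\<^esub> laurent_map \<alpha> 0 f \<otimes>\<^bsub>B\<^esub> ore_derivation g)"
proof -
  interpret B: poisson_algebra K B by (rule laurent_poisson_poisson_algebra)
  interpret X: derivation K B ore_derivation by (rule derivation_ore_derivation)
  interpret c: derivation K B "laurent_map \<alpha> 0" by (rule derivation_laurent_map[OF derivation_axioms])
  let ?X = ore_derivation and ?c = "laurent_map \<alpha> 0"
  \<comment> \<open>Both sides are biadditive in \<open>f\<close> and \<open>g\<close>, so monomials suffice.\<close>
  define E where "E f g = (\<lbrace>?X f, g\<rbrace>\<^bsub>B\<^esub> \<oplus>\<^bsub>B\<^esub> \<lbrace>f, ?X g\<rbrace>\<^bsub>B\<^esub>) \<oplus>\<^bsub>B\<^esub> (?X f \<otimes>\<^bsub>B\<^esub> ?c g \<ominus>\<^bsub>B\<^esub> ?c f \<otimes>\<^bsub>B\<^esub> ?X g)" for f g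
  have E_add_left: "E (f \<oplus>\<^bsub>B\<^esub> h) g = E f g \<oplus>\<^bsub>B\<^esub> E h g"
    if "f \<in> carrier B" "g \<in> carrier B" "h \<in> carrier B" for f g h
    using that by (simp add: E_def X.der_add c.der_add X.der_closed c.der_closed laurent_poisson_pbracket_add
        laurent_poisson_pbracket_closed
      B.l_distr B.r_distr B.M.minus_eq B.M.minus_add B.M.a_ac)
  have E_add_right: "E f (g \<oplus>\<^bsub>B\<^esub> h) = E f g \<oplus>\<^bsub>B\<^esub> E f h"
    if "f \<in> carrier B" "g \<in> carrier B" "h \<in> carrier B" for f g h
    using that by (simp add: E_def X.der_add c.der_add X.der_closed c.der_closed laurent_poisson_pbracket_add
        laurent_poisson_pbracket_closed
      B.l_distr B.r_distr B.M.minus_eq B.M.minus_add B.M.a_ac)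
  have E_monom: "?X \<lbrace>laurent_monom A a i, laurent_monom A b j\<rbrace>\<^bsub>B\<^esub> = E (laurent_monom A a i) (laurent_monom A b j)"
    if ab: "a \<in> carrier A" "b \<in> carrier A" for a b i j
  proof -
    \<comment> \<open>Only the two exponents \<open>i + j\<close> and \<open>i + j - 1\<close> occur.\<close>
    let ?m = "\<lambda>x. laurent_monom A x (i + j)" and ?n = "\<lambda>x. laurent_monom A x (i + j - 1)"
    have in_A: "\<alpha> a \<in> carrier A" "\<alpha> b \<in> carrier A" "\<delta> a \<in> carrier A" "\<delta> b \<in> carrier A"
      using ab by (simp_all add: der_closed \<delta>.der_closed)
    have exponents: "i - 1 + j = i + j - 1" "i + (j - 1) = i + j - 1" by simp_all
    have "E (laurent_monom A a i) (laurent_monom A b j)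
      = ((?m \<lbrace>\<alpha> a, b\<rbrace> \<oplus>\<^bsub>B\<^esub> ?n \<lbrace>\<delta> a, b\<rbrace>) \<oplus>\<^bsub>B\<^esub> (?m \<lbrace>a, \<alpha> b\<rbrace> \<oplus>\<^bsub>B\<^esub> ?n \<lbrace>a, \<delta> b\<rbrace>))
      \<oplus>\<^bsub>B\<^esub> ((?m (\<alpha> a \<otimes> \<alpha> b) \<oplus>\<^bsub>B\<^esub> ?n (\<delta> a \<otimes> \<alpha> b)) \<ominus>\<^bsub>B\<^esub> (?m (\<alpha> a \<otimes> \<alpha> b) \<oplus>\<^bsub>B\<^esub> ?n (\<alpha> a \<otimes> \<delta> b)))"
      using ab in_A
      by (simp add: E_def ore_derivation_monom laurent_map_monom[OF derivation_axioms]
          laurent_poisson_pbracket_add laurent_poisson_monom_closed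
          laurent_poisson_monom_pbracket laurent_poisson_monom_mult B.l_distr B.r_distr exponents)
    also have "\<dots> = (?m \<lbrace>\<alpha> a, b\<rbrace> \<oplus>\<^bsub>B\<^esub> ?m \<lbrace>a, \<alpha> b\<rbrace>)
      \<oplus>\<^bsub>B\<^esub> ((?n \<lbrace>\<delta> a, b\<rbrace> \<oplus>\<^bsub>B\<^esub> ?n \<lbrace>a, \<delta> b\<rbrace>) \<oplus>\<^bsub>B\<^esub> (?n (\<delta> a \<otimes> \<alpha> b) \<ominus>\<^bsub>B\<^esub> ?n (\<alpha> a \<otimes> \<delta> b)))"
    proof -
      have "?m \<lbrace>\<alpha> a, b\<rbrace> \<in> carrier B" "?m \<lbrace>a, \<alpha> b\<rbrace> \<in> carrier B" "?m (\<alpha> a \<otimes> \<alpha> b) \<in> carrier B"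
        "?n \<lbrace>\<delta> a, b\<rbrace> \<in> carrier B" "?n \<lbrace>a, \<delta> b\<rbrace> \<in> carrier B" "?n (\<delta> a \<otimes> \<alpha> b) \<in> carrier B"
            "?n (\<alpha> a \<otimes> \<delta> b) \<in> carrier B"
        using ab in_A by (simp_all add: laurent_poisson_monom_closed pbracket_closed)
      then show ?thesis by algebra
    qed
    also have "\<dots> = ?X \<lbrace>laurent_monom A a i, laurent_monom A b j\<rbrace>\<^bsub>B\<^esub>"
      using ab in_A
      by (simp add: laurent_poisson_monom_pbracket ore_derivation_monom der_pbracket \<delta>_pbracket
          laurent_poisson_monom_minus pbracket_closed
          laurent_poisson_monom_add[symmetric])
    finally show ?thesis by simp
  qed
  have "?X \<lbrace>f, g\<rbrace>\<^bsub>B\<^esub> = E f g" using assms(1)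
  proof (induction f rule: laurent_poisson_induct)
    case (monom a i)
    show ?case using assms(2) monom
      by (induction g rule: laurent_poisson_induct)
        (simp_all add: E_monom E_add_right laurent_poisson_pbracket_add laurent_poisson_pbracket_closed
            laurent_poisson_monom_closed X.der_add)
  qed (use assms(2) in \<open>simp add: E_add_left laurent_poisson_pbracket_add laurent_poisson_pbracket_closed
      X.der_add\<close>)
  then show ?thesis by (simp add: E_def)
qed

text \<open>
  The part \<open>\<alpha>\<close> of the Ore derivation commutes with \<open>x d/dx\<close>, whereas \<open>x^(-1) \<delta>\<close> lowers the degree by
  one, so that the commutator is \<open>- x^(-1) \<delta>\<close>.
\<close>

lemma euler_ore_derivation:
  assumes f: "f \<in> carrier B"
  shows "laurent_euler A (ore_derivation f)
    = (ore_derivation (laurent_euler A f) \<oplus>\<^bsub>B\<^esub> laurent_map \<alpha> 0 f) \<ominus>\<^bsub>B\<^esub> ore_derivation f"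
proof
  fix n
  interpret B: poisson_algebra K B by (rule laurent_poisson_poisson_algebra)
  interpret D: poisson_derivation K B "laurent_euler A" by (rule poisson_derivation_laurent_euler)
  interpret X: derivation K B ore_derivation by (rule derivation_ore_derivation)
  interpret c: derivation K B "laurent_map \<alpha> 0" by (rule derivation_laurent_map[OF derivation_axioms])
  have pow: "d ([(m :: int)] \<cdot> a) = [m] \<cdot> d a" if "derivation K A d" "a \<in> carrier A" for d m a
    using that by (intro additive_add_pow M.abelian_group_axioms) (auto simp: derivation.der_closed
        derivation.der_add)
  have X: "ore_derivation h m = \<alpha> (h m) \<oplus> \<delta> (h (m + 1))" for h m
    by (simp add: ore_derivation_def laurent_map_def laurent_poisson_add_apply)
  define a d where "a = \<alpha> (f n)" and "d = \<delta> (f (n + 1))"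
  have in_A: "a \<in> carrier A" "d \<in> carrier A"
    using f by (simp_all add: a_def d_def der_closed \<delta>.der_closed laurent_poisson_apply_closed)
  then have pow_A: "[n] \<cdot> a \<in> carrier A" "[n] \<cdot> d \<in> carrier A" by simp_all
  have "laurent_euler A (ore_derivation f) n = [n] \<cdot> a \<oplus> [n] \<cdot> d"
    using in_A by (simp add: laurent_euler_def X M.add.int_pow_distrib flip: a_def d_def)
  also have "\<dots> = (([n] \<cdot> a \<oplus> ([n] \<cdot> d \<oplus> d)) \<oplus> a) \<ominus> (a \<oplus> d)"
    using in_A pow_A by algebra
  also have "\<dots> = (ore_derivation (laurent_euler A f) n \<oplus> laurent_map \<alpha> 0 f n) \<ominus> ore_derivation f n"
    using f in_A
    by (simp add: X laurent_poisson_apply_closed laurent_map_def laurent_euler_def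
        pow[OF derivation_axioms] pow[OF \<delta>.derivation_axioms] M.add.int_pow_mult \<delta>.der_add flip: a_def d_def)
  also have "\<dots> = ((ore_derivation (laurent_euler A f) \<oplus>\<^bsub>B\<^esub> laurent_map \<alpha> 0 f) \<ominus>\<^bsub>B\<^esub> ore_derivation f) n"
    using f by (simp add: D.der_closed X.der_closed c.der_closed laurent_poisson_minus_apply
        laurent_poisson_add_apply)
  finally show "laurent_euler A (ore_derivation f) n
    = ((ore_derivation (laurent_euler A f) \<oplus>\<^bsub>B\<^esub> laurent_map \<alpha> 0 f) \<ominus>\<^bsub>B\<^esub> ore_derivation f) n" .
qed

lemma poisson_twist_laurent: "poisson_twist K B (laurent_euler A) ore_derivation (laurent_map \<alpha> 0)"
  by (intro poisson_twist.intro poisson_twist_axioms.intro poisson_derivation_laurent_euler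
      derivation_ore_derivation
      derivation.der_closed[OF derivation_laurent_map[OF derivation_axioms]] ore_derivation_pbracket
          euler_ore_derivation)

end

section \<open>The Poisson Laurent Ore extension\<close>

context poisson_pair
begin

interpretation T: poisson_twist K "laurent_poisson A" "laurent_euler A" ore_derivation "laurent_map \<alpha> 0"
  by (rule poisson_twist_laurent)

lemma ore_coeff_closed:
  assumes "a \<in> carrier A" "b \<in> carrier A"
  shows "ore_coeff_hi A \<alpha> a i b j \<in> carrier A" "ore_coeff_lo A \<delta> a i b j \<in> carrier A"
  using assms by (simp_all add: ore_coeff_hi_def ore_coeff_lo_def pbracket_closed der_closed \<delta>.der_closed)

lemma twisted_bracket_monom:
  assumes ab: "a \<in> carrier A" "b \<in> carrier A"
  shows "T.twisted_bracket (laurent_monom A a i) (laurent_monom A b j)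
    = laurent_monom A (ore_coeff_hi A \<alpha> a i b j) (i + j) \<oplus>\<^bsub>B\<^esub> laurent_monom A (ore_coeff_lo A \<delta> a i b j) (i + j
        - 1)"
proof -
  let ?m = "\<lambda>x. laurent_monom A x (i + j)" and ?n = "\<lambda>x. laurent_monom A x (i + j - 1)"
  have in_A: "\<alpha> a \<in> carrier A" "\<alpha> b \<in> carrier A" "\<delta> a \<in> carrier A" "\<delta> b \<in> carrier A"
    using ab by (simp_all add: der_closed \<delta>.der_closed)
  have exponents: "i - 1 + j = i + j - 1" "i + (j - 1) = i + j - 1" by simp_all
  have "T.twisted_bracket (laurent_monom A a i) (laurent_monom A b j) = ?m \<lbrace>a, b\<rbrace> \<oplus>\<^bsub>B\<^esub>
    ((?m ([j] \<cdot> (\<alpha> a \<otimes> b)) \<oplus>\<^bsub>B\<^esub> ?n ([j] \<cdot> (\<delta> a \<otimes> b))) \<ominus>\<^bsub>B\<^esub> (?m ([i] \<cdot> (a \<otimes> \<alpha> b)) \<oplus>\<^bsub>B\<^esub> ?n ([i] \<cdot> (a \<otimes> \<delta> b))))"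
    using ab in_A
    by (simp add: T.twisted_bracket_def ore_derivation_monom laurent_euler_monom
        laurent_poisson_monom_pbracket laurent_poisson_monom_mult
        laurent_poisson_monom_closed T.D.l_distr T.D.r_distr add_pow_ldistr_int add_pow_rdistr_int exponents)
  also have "\<dots> = ((?m \<lbrace>a, b\<rbrace> \<oplus>\<^bsub>B\<^esub> ?m ([j] \<cdot> (\<alpha> a \<otimes> b))) \<ominus>\<^bsub>B\<^esub> ?m ([i] \<cdot> (a \<otimes> \<alpha> b)))
    \<oplus>\<^bsub>B\<^esub> (?n ([j] \<cdot> (\<delta> a \<otimes> b)) \<ominus>\<^bsub>B\<^esub> ?n ([i] \<cdot> (a \<otimes> \<delta> b)))"
  proof -
    have "?m \<lbrace>a, b\<rbrace> \<in> carrier B" "?m ([j] \<cdot> (\<alpha> a \<otimes> b)) \<in> carrier B" "?m ([i] \<cdot> (a \<otimes> \<alpha> b)) \<in> carrier B"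
      "?n ([j] \<cdot> (\<delta> a \<otimes> b)) \<in> carrier B" "?n ([i] \<cdot> (a \<otimes> \<delta> b)) \<in> carrier B"
      using ab in_A by (simp_all add: laurent_poisson_monom_closed pbracket_closed)
    then show ?thesis by algebra
  qed
  also have "\<dots> = ?m (ore_coeff_hi A \<alpha> a i b j) \<oplus>\<^bsub>B\<^esub> ?n (ore_coeff_lo A \<delta> a i b j)"
    using ab in_A
    by (simp add: ore_coeff_hi_def ore_coeff_lo_def laurent_poisson_monom_minus
        laurent_poisson_monom_add[symmetric] pbracket_closed)
  finally show ?thesis .
qed

lemma twisted_bracket_finsum:
  assumes "finite S" "F \<in> S \<rightarrow> carrier B" "finite S'" "F' \<in> S' \<rightarrow> carrier B"
  shows "T.twisted_bracket (\<Oplus>\<^bsub>B\<^esub>i \<in> S. F i) (\<Oplus>\<^bsub>B\<^esub>j \<in> S'. F' j)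
    = (\<Oplus>\<^bsub>B\<^esub>i \<in> S. \<Oplus>\<^bsub>B\<^esub>j \<in> S'. T.twisted_bracket (F i) (F' j))"
proof -
  have "T.twisted_bracket (\<Oplus>\<^bsub>B\<^esub>i \<in> S. F i) (\<Oplus>\<^bsub>B\<^esub>j \<in> S'. F' j)
    = (\<Oplus>\<^bsub>B\<^esub>i \<in> S. T.twisted_bracket (F i) (\<Oplus>\<^bsub>B\<^esub>j \<in> S'. F' j))"
    using assms
    by (intro additive_finsum[where h = "\<lambda>f. T.twisted_bracket f (\<Oplus>\<^bsub>B\<^esub>j \<in> S'. F' j)"] T.D.M.abelian_group_axioms)
      (simp_all add: T.twisted_bracket_closed T.twisted_bracket_add_left)
  also have "\<dots> = (\<Oplus>\<^bsub>B\<^esub>i \<in> S. \<Oplus>\<^bsub>B\<^esub>j \<in> S'. T.twisted_bracket (F i) (F' j))"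
  proof (rule T.D.M.finsum_cong')
    show "(\<lambda>i. \<Oplus>\<^bsub>B\<^esub>j \<in> S'. T.twisted_bracket (F i) (F' j)) \<in> S \<rightarrow> carrier B"
      using assms by (auto intro!: T.D.M.finsum_closed T.twisted_bracket_closed)
    fix i assume "i \<in> S"
    with assms show "T.twisted_bracket (F i) (\<Oplus>\<^bsub>B\<^esub>j \<in> S'. F' j) = (\<Oplus>\<^bsub>B\<^esub>j \<in> S'. T.twisted_bracket (F i) (F' j))"
      by (intro additive_finsum[where h = "\<lambda>f. T.twisted_bracket (F i) f"] T.D.M.abelian_group_axioms)
        (auto simp: T.twisted_bracket_closed T.twisted_bracket_add_right Pi_iff)
  qed simp
  finally show ?thesis .
qed

text \<open>
  Expanding both arguments of the twisted bracket into monomials gives the explicit double sum.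
\<close>

lemma laurent_ore_bracket_eq:
  assumes f: "f \<in> carrier B" and g: "g \<in> carrier B"
  shows "laurent_ore_bracket A \<alpha> \<delta> f g = T.twisted_bracket f g"
proof -
  have L: "f \<in> carrier (laurent_ring A)" "g \<in> carrier (laurent_ring A)"
    using f g by (simp_all add: laurent_poisson_def)
  have add: "add (laurent_ring A) = add B"
    by (simp add: laurent_poisson_def)
  have "laurent_ore_bracket A \<alpha> \<delta> f g = (\<Oplus>\<^bsub>B\<^esub>i \<in> laurent_supp A f. \<Oplus>\<^bsub>B\<^esub>j \<in> laurent_supp A g.
      T.twisted_bracket (laurent_monom A (f i) i) (laurent_monom A (g j) j))"
    unfolding laurent_ore_bracket_def laurent_poisson_finsum add
    using f g by (simp add: twisted_bracket_monom laurent_poisson_apply_closed)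
  also have "\<dots> = T.twisted_bracket (\<Oplus>\<^bsub>B\<^esub>i \<in> laurent_supp A f. laurent_monom A (f i) i)
      (\<Oplus>\<^bsub>B\<^esub>j \<in> laurent_supp A g. laurent_monom A (g j) j)"
    using L f g by (intro twisted_bracket_finsum[symmetric]) (auto simp: laurent_poisson_monom_closed
        laurent_poisson_apply_closed)
  also have "\<dots> = T.twisted_bracket f g"
    unfolding laurent_poisson_finsum[symmetric] using L by (simp add: M.laurent_expand)
  finally show ?thesis .
qed

theorem poisson_algebra_laurent_ore: "poisson_algebra K (poisson_laurent_ore A \<alpha> \<delta>)"
proof -
  have "poisson_laurent_ore A \<alpha> \<delta> = B\<lparr>pbracket := laurent_ore_bracket A \<alpha> \<delta>\<rparr>"
    by (simp add: poisson_laurent_ore_def laurent_poisson_def)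
  then show ?thesis
    using T.poisson_algebra_twisted[OF laurent_ore_bracket_eq] by simp
qed

end

section \<open>The Poisson Ore extension inside the Laurent extension\<close>

text \<open>
  The Poisson axioms are identities between the operations; an injection that respects the operations
  therefore reflects them.
\<close>

lemma poisson_algebra_embedding:
  assumes "poisson_algebra K B" "cring C"
    and inj: "inj_on \<phi> (carrier C)"
    and \<phi>_closed: "\<And>p. p \<in> carrier C \<Longrightarrow> \<phi> p \<in> carrier B"
    and add: "\<And>p q. \<lbrakk>p \<in> carrier C; q \<in> carrier C\<rbrakk> \<Longrightarrow> \<phi> (p \<oplus>\<^bsub>C\<^esub> q) = \<phi> p \<oplus>\<^bsub>B\<^esub> \<phi> q"
    and mult: "\<And>p q. \<lbrakk>p \<in> carrier C; q \<in> carrier C\<rbrakk> \<Longrightarrow> \<phi> (p \<otimes>\<^bsub>C\<^esub> q) = \<phi> p \<otimes>\<^bsub>B\<^esub> \<phi> q"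
    and smult_closed: "\<And>k p. \<lbrakk>k \<in> carrier K; p \<in> carrier C\<rbrakk> \<Longrightarrow> k \<odot>\<^bsub>C\<^esub> p \<in> carrier C"
    and smult: "\<And>k p. \<lbrakk>k \<in> carrier K; p \<in> carrier C\<rbrakk> \<Longrightarrow> \<phi> (k \<odot>\<^bsub>C\<^esub> p) = k \<odot>\<^bsub>B\<^esub> \<phi> p"
    and br_closed: "\<And>p q. \<lbrakk>p \<in> carrier C; q \<in> carrier C\<rbrakk> \<Longrightarrow> \<lbrace>p, q\<rbrace>\<^bsub>C\<^esub> \<in> carrier C"
    and br: "\<And>p q. \<lbrakk>p \<in> carrier C; q \<in> carrier C\<rbrakk> \<Longrightarrow> \<phi> \<lbrace>p, q\<rbrace>\<^bsub>C\<^esub> = \<lbrace>\<phi> p, \<phi> q\<rbrace>\<^bsub>B\<^esub>"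
  shows "poisson_algebra K C"
proof -
  interpret B: poisson_algebra K B by fact
  interpret C: cring C by fact
  note closed = smult_closed br_closed \<phi>_closed
  note hom = add mult smult br
  have zero: "\<phi> \<zero>\<^bsub>C\<^esub> = \<zero>\<^bsub>B\<^esub>"
    using add[of "\<zero>\<^bsub>C\<^esub>" "\<zero>\<^bsub>C\<^esub>"] by (simp add: \<phi>_closed B.M.add.l_cancel_one)
  have "algebra K C"
    by (intro algebraI B.R_cring \<open>cring C\<close> inj_onD[OF inj])
      (simp_all add: closed hom B.smult_l_distr B.smult_r_distr B.smult_assoc1 B.smult_assoc2)
  then show ?thesis
    by (intro poisson_algebra.intro poisson_algebra_axioms.intro; (intro inj_onD[OF inj])?)
      (simp_all add: closed hom zero B.pbracket_add_left B.pbracket_add_right B.pbracket_smult_left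
          B.pbracket_smult_right
        B.pbracket_self B.pbracket_jacobi[symmetric] B.pbracket_leibniz)
qed

lemma (in UP_ring) UP_induct [consumes 1, case_names monom add]:
  assumes p: "p \<in> carrier P"
    and monom: "\<And>a i. a \<in> carrier R \<Longrightarrow> Q (monom P a i)"
    and add: "\<And>p q. \<lbrakk>p \<in> carrier P; q \<in> carrier P; Q p; Q q\<rbrakk> \<Longrightarrow> Q (p \<oplus>\<^bsub>P\<^esub> q)"
  shows "Q p"
proof -
  have "Q (\<Oplus>\<^bsub>P\<^esub>i \<in> S. monom P (coeff P p i) i)" if "finite S" for S
    using that
  proof (induction S rule: finite_induct)
    case empty
    then show ?case using monom[of \<zero> 0] by simp
  next
    case (insert j S)
    then show ?case using p by (subst P.finsum_insert) (auto intro!: add monom)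
  qed
  from this[of "{..deg R p}"] show ?thesis using up_repr[OF p] by simp
qed

text \<open>
  The inclusion of \<open>A[x]\<close> in the Laurent polynomials. Through it the Poisson axioms for
  \<open>A[x; \<alpha>, \<delta>]\<close> are inherited rather than verified a second time.
\<close>

definition laurent_of_poly :: "('a, 'm) ring_scheme \<Rightarrow> (nat \<Rightarrow> 'a) \<Rightarrow> int \<Rightarrow> 'a"
  where "laurent_of_poly R p = (\<lambda>n. if n < 0 then \<zero>\<^bsub>R\<^esub> else coeff (UP R) p (nat n))"

context poisson_algebra
begin

interpretation P: UP_cring A "UP A"
  by (intro UP_cring.intro cring_axioms) simp

abbreviation (input) "\<phi> \<equiv> laurent_of_poly A"

lemma laurent_of_poly_add:
  "\<lbrakk>p \<in> carrier (UP A); q \<in> carrier (UP A)\<rbrakk> \<Longrightarrow> \<phi> (p \<oplus>\<^bsub>UP A\<^esub> q) = \<phi> p \<oplus>\<^bsub>B\<^esub> \<phi> q"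
  by (simp add: fun_eq_iff laurent_of_poly_def laurent_poisson_add_apply)

lemma laurent_of_poly_monom: "a \<in> carrier A \<Longrightarrow> \<phi> (monom (UP A) a i) = laurent_monom A a (int i)"
  by (auto simp: fun_eq_iff laurent_of_poly_def laurent_monom_apply)

lemma laurent_of_poly_closed: "p \<in> carrier (UP A) \<Longrightarrow> \<phi> p \<in> carrier B"
proof (induction p rule: P.UP_induct)
  interpret B: cring B by (rule laurent_poisson_cring)
  case (add p q)
  then show ?case by (simp add: laurent_of_poly_add)
qed (simp add: laurent_of_poly_monom laurent_poisson_monom_closed)

lemma inj_laurent_of_poly: "inj_on \<phi> (carrier (UP A))"
proof (rule inj_onI, rule P.up_eqI)
  fix p q n assume "\<phi> p = \<phi> q"
  from fun_cong[OF this, of "int n"] show "coeff (UP A) p n = coeff (UP A) q n"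
    by (simp add: laurent_of_poly_def)
qed

lemma laurent_of_poly_mult:
  assumes "p \<in> carrier (UP A)" "q \<in> carrier (UP A)"
  shows "\<phi> (p \<otimes>\<^bsub>UP A\<^esub> q) = \<phi> p \<otimes>\<^bsub>B\<^esub> \<phi> q"
  using assms(1)
proof (induction p rule: P.UP_induct)
  interpret B: cring B by (rule laurent_poisson_cring)
  case (monom a i)
  show ?case using assms(2) monom
    by (induction q rule: P.UP_induct)
      (simp_all add: laurent_of_poly_add laurent_of_poly_monom laurent_of_poly_closed P.P.r_distr B.r_distr
        laurent_poisson_monom_mult laurent_poisson_monom_closed P.monom_mult[symmetric] del: P.monom_mult)
next
  interpret B: cring B by (rule laurent_poisson_cring)
  case (add p r)
  with assms(2) show ?case
    by (simp add: laurent_of_poly_add laurent_of_poly_closed P.P.l_distr B.l_distr)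
qed

lemma laurent_of_poly_finsum:
  assumes "finite S" "F \<in> S \<rightarrow> carrier (UP A)"
  shows "\<phi> (\<Oplus>\<^bsub>UP A\<^esub>i \<in> S. F i) = (\<Oplus>\<^bsub>B\<^esub>i \<in> S. \<phi> (F i))"
proof -
  interpret B: cring B by (rule laurent_poisson_cring)
  show ?thesis
    using assms by (intro additive_finsum[where h = \<phi>] P.P.abelian_group_axioms B.abelian_group_axioms)
      (simp_all add: laurent_of_poly_closed laurent_of_poly_add)
qed

lemma laurent_of_poly_expand:
  assumes "p \<in> carrier (UP A)"
  shows "\<phi> p = (\<Oplus>\<^bsub>B\<^esub>i \<in> {..deg A p}. laurent_monom A (coeff (UP A) p i) (int i))"
proof -
  interpret B: cring B by (rule laurent_poisson_cring)
  have "\<phi> p = (\<Oplus>\<^bsub>B\<^esub>i \<in> {..deg A p}. \<phi> (monom (UP A) (coeff (UP A) p i) i))"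
    using laurent_of_poly_finsum[of "{..deg A p}" "\<lambda>i. monom (UP A) (coeff (UP A) p i) i"] assms P.up_repr[OF
        assms] by simp
  also have "\<dots> = (\<Oplus>\<^bsub>B\<^esub>i \<in> {..deg A p}. laurent_monom A (coeff (UP A) p i) (int i))"
    using assms by (intro B.finsum_cong') (auto simp: laurent_of_poly_monom laurent_poisson_monom_closed)
  finally show ?thesis .
qed

end

context poisson_pair
begin

interpretation P: UP_cring A "UP A"
  by (intro UP_cring.intro cring_axioms) simp

interpretation T: poisson_twist K "laurent_poisson A" "laurent_euler A" ore_derivation "laurent_map \<alpha> 0"
  by (rule poisson_twist_laurent)

lemma ore_bracket_summand_closed:
  assumes "p \<in> carrier (UP A)" "q \<in> carrier (UP A)"
  shows "monom (UP A) (ore_coeff_hi A \<alpha> (coeff (UP A) p i) (int i) (coeff (UP A) q j) (int j)) (i + j)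
      \<oplus>\<^bsub>UP A\<^esub>
      (if i = 0 \<and> j = 0 then \<zero>\<^bsub>UP A\<^esub>
       else monom (UP A) (ore_coeff_lo A \<delta> (coeff (UP A) p i) (int i) (coeff (UP A) q j) (int j)) (i + j - 1))
     \<in> carrier (UP A)"
  using assms by (simp add: ore_coeff_closed)

lemma ore_bracket_closed:
  assumes "p \<in> carrier (UP A)" "q \<in> carrier (UP A)"
  shows "ore_bracket A \<alpha> \<delta> p q \<in> carrier (UP A)"
  unfolding ore_bracket_def using ore_bracket_summand_closed[OF assms]
  by (intro P.P.finsum_closed Pi_I)

text \<open>
  At \<open>i = j = 0\<close> the ordinary bracket leaves out the summand with exponent \<open>-1\<close>; its coefficient in
  the Laurent bracket is zero there.
\<close>

lemma laurent_of_poly_ore_bracket: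
  assumes p: "p \<in> carrier (UP A)" and q: "q \<in> carrier (UP A)"
  shows "\<phi> (ore_bracket A \<alpha> \<delta> p q) = T.twisted_bracket (\<phi> p) (\<phi> q)"
proof -
  let ?s = "\<lambda>i j. monom (UP A) (ore_coeff_hi A \<alpha> (coeff (UP A) p i) (int i) (coeff (UP A) q j) (int j)) (i + j)
      \<oplus>\<^bsub>UP A\<^esub>
      (if i = 0 \<and> j = 0 then \<zero>\<^bsub>UP A\<^esub>
       else monom (UP A) (ore_coeff_lo A \<delta> (coeff (UP A) p i) (int i) (coeff (UP A) q j) (int j)) (i + j - 1))"
  let ?m = "\<lambda>p i. laurent_monom A (coeff (UP A) p i) (int i)"
  have s: "?s i j \<in> carrier (UP A)" for i j
    using p q by (rule ore_bracket_summand_closed)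
  have \<phi>_s: "\<phi> (?s i j) = T.twisted_bracket (?m p i) (?m q j)" for i j
  proof (cases "i = 0 \<and> j = 0")
    case True
    have "ore_coeff_lo A \<delta> a 0 b 0 = \<zero>" if "a \<in> carrier A" "b \<in> carrier A" for a b
      using that by (simp add: ore_coeff_lo_def M.minus_eq \<delta>.der_closed add_pow_def)
    then show ?thesis
      using True p q
      by (simp add: twisted_bracket_monom ore_coeff_closed laurent_of_poly_monom laurent_poisson_monom_zero
          laurent_poisson_monom_closed)
  next
    case False
    then have "int (i + j - 1) = int i + int j - 1" by auto
    then show ?thesis
      unfolding if_not_P[OF False] using p q
      by (simp add: twisted_bracket_monom ore_coeff_closed laurent_of_poly_add laurent_of_poly_monom del:
          of_nat_diff)
  qed
  have "\<phi> (ore_bracket A \<alpha> \<delta> p q) = (\<Oplus>\<^bsub>B\<^esub>i \<in> {..deg A p}. \<phi> (\<Oplus>\<^bsub>UP A\<^esub>j \<in> {..deg A q}. ?s i j))"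
    unfolding ore_bracket_def using s by (intro laurent_of_poly_finsum) (auto intro!: P.P.finsum_closed)
  also have "\<dots> = (\<Oplus>\<^bsub>B\<^esub>i \<in> {..deg A p}. \<Oplus>\<^bsub>B\<^esub>j \<in> {..deg A q}. T.twisted_bracket (?m p i) (?m q j))"
  proof -
    have "\<phi> (\<Oplus>\<^bsub>UP A\<^esub>j \<in> {..deg A q}. ?s i j) = (\<Oplus>\<^bsub>B\<^esub>j \<in> {..deg A q}. \<phi> (?s i j))" for i
      using s by (intro laurent_of_poly_finsum) auto
    then show ?thesis unfolding \<phi>_s by simp
  qed
  also have "\<dots> = T.twisted_bracket (\<phi> p) (\<phi> q)"
    unfolding laurent_of_poly_expand[OF p] laurent_of_poly_expand[OF q]
    using p q by (intro twisted_bracket_finsum[symmetric]) (auto simp: laurent_poisson_monom_closed)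
  finally show ?thesis .
qed

lemma poisson_ore_cring: "cring (poisson_ore A \<alpha> \<delta>)"
  by (rule cring_cong[OF P.UP_cring]) (simp_all add: poisson_ore_def)

lemma poisson_ore_smult:
  assumes "k \<in> carrier K" "p \<in> carrier (UP A)"
  shows "k \<odot>\<^bsub>poisson_ore A \<alpha> \<delta>\<^esub> p \<in> carrier (UP A)" "\<phi> (k \<odot>\<^bsub>poisson_ore A \<alpha> \<delta>\<^esub> p) = k \<odot>\<^bsub>B\<^esub> \<phi> p"
proof -
  have eq: "k \<odot>\<^bsub>poisson_ore A \<alpha> \<delta>\<^esub> p = (\<lambda>i. k \<odot> coeff (UP A) p i)"
    by (simp add: poisson_ore_def)
  have "bound \<zero> (deg A p) (\<lambda>i. k \<odot> coeff (UP A) p i)"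
    using assms by (intro bound.intro) (simp add: P.deg_aboveD)
  then have up: "(\<lambda>i. k \<odot> coeff (UP A) p i) \<in> up A"
    using assms by (intro mem_upI) auto
  then show "k \<odot>\<^bsub>poisson_ore A \<alpha> \<delta>\<^esub> p \<in> carrier (UP A)"
    by (simp add: eq UP_def)
  have "coeff (UP A) (\<lambda>i. k \<odot> coeff (UP A) p i) n = k \<odot> coeff (UP A) p n" for n
    using up by (simp add: UP_def)
  then show "\<phi> (k \<odot>\<^bsub>poisson_ore A \<alpha> \<delta>\<^esub> p) = k \<odot>\<^bsub>B\<^esub> \<phi> p"
    using assms by (simp add: eq fun_eq_iff laurent_of_poly_def laurent_poisson_smult_apply)
qed

lemma poisson_ore_simps:
  "carrier (poisson_ore A \<alpha> \<delta>) = carrier (UP A)" "mult (poisson_ore A \<alpha> \<delta>) = mult (UP A)"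
  "one (poisson_ore A \<alpha> \<delta>) = one (UP A)" "zero (poisson_ore A \<alpha> \<delta>) = zero (UP A)"
  "add (poisson_ore A \<alpha> \<delta>) = add (UP A)" "pbracket (poisson_ore A \<alpha> \<delta>) = ore_bracket A \<alpha> \<delta>"
  by (simp_all add: poisson_ore_def)

lemma laurent_of_poly_pbracket:
  "\<lbrakk>p \<in> carrier (UP A); q \<in> carrier (UP A)\<rbrakk> \<Longrightarrow>
    \<phi> (ore_bracket A \<alpha> \<delta> p q) = laurent_ore_bracket A \<alpha> \<delta> (\<phi> p) (\<phi> q)"
  by (simp add: laurent_of_poly_ore_bracket laurent_ore_bracket_eq laurent_of_poly_closed)

lemma poisson_laurent_ore_simps:
  "carrier (poisson_laurent_ore A \<alpha> \<delta>) = carrier B" "mult (poisson_laurent_ore A \<alpha> \<delta>) = mult B"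
  "one (poisson_laurent_ore A \<alpha> \<delta>) = one B" "zero (poisson_laurent_ore A \<alpha> \<delta>) = zero B"
  "add (poisson_laurent_ore A \<alpha> \<delta>) = add B" "smult (poisson_laurent_ore A \<alpha> \<delta>) = smult B"
  "pbracket (poisson_laurent_ore A \<alpha> \<delta>) = laurent_ore_bracket A \<alpha> \<delta>"
  by (simp_all add: poisson_laurent_ore_def laurent_poisson_def)

theorem poisson_algebra_ore: "poisson_algebra K (poisson_ore A \<alpha> \<delta>)"
  by (rule poisson_algebra_embedding[OF poisson_algebra_laurent_ore poisson_ore_cring, where \<phi> = \<phi>])
    (simp_all add: poisson_ore_simps poisson_laurent_ore_simps poisson_ore_smult laurent_of_poly_pbracket
      laurent_of_poly_closed laurent_of_poly_add laurent_of_poly_mult inj_laurent_of_poly ore_bracket_closed)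

end

section \<open>Poisson ideals\<close>

context poisson_algebra
begin

lemma poisson_idealI:
  assumes sub: "I \<subseteq> carrier A" and zero: "\<zero> \<in> I"
    and add: "\<And>x y. \<lbrakk>x \<in> I; y \<in> I\<rbrakk> \<Longrightarrow> x \<oplus> y \<in> I"
    and mult: "\<And>a x. \<lbrakk>a \<in> carrier A; x \<in> I\<rbrakk> \<Longrightarrow> a \<otimes> x \<in> I"
    and br: "\<And>a x. \<lbrakk>a \<in> carrier A; x \<in> I\<rbrakk> \<Longrightarrow> \<lbrace>a, x\<rbrace> \<in> I"
  shows "poisson_ideal I A"
proof (intro poisson_ideal.intro poisson_ideal_axioms.intro idealI)
  have neg: "\<ominus> x \<in> I" if "x \<in> I" for x
    using mult[of "\<ominus> \<one>" x] that sub by (auto simp: l_minus)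
  show "subgroup I (add_monoid A)"
    using sub zero add neg by (intro add.subgroupI) auto
  show "x \<otimes> a \<in> I" if "a \<in> I" "x \<in> carrier A" for a x
    using mult that by simp
  show "a \<otimes> x \<in> I" if "a \<in> I" "x \<in> carrier A" for a x
    using mult[of x a] that sub by (auto simp: m_comm)
qed (use br in \<open>auto intro: ring_axioms\<close>)

lemma poisson_idealD:
  assumes "poisson_ideal I A"
  shows "I \<subseteq> carrier A" "\<zero> \<in> I" "\<lbrakk>x \<in> I; y \<in> I\<rbrakk> \<Longrightarrow> x \<oplus> y \<in> I" "\<lbrakk>x \<in> I; y \<in> I\<rbrakk> \<Longrightarrow> x \<ominus> y \<in> I"
    "\<lbrakk>a \<in> carrier A; x \<in> I\<rbrakk> \<Longrightarrow> a \<otimes> x \<in> I" "\<lbrakk>a \<in> carrier A; x \<in> I\<rbrakk> \<Longrightarrow> \<lbrace>a, x\<rbrace> \<in> I"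
proof -
  interpret I: poisson_ideal I A by fact
  show "I \<subseteq> carrier A" "\<zero> \<in> I" by (auto simp: I.a_subset)
  show "\<lbrakk>x \<in> I; y \<in> I\<rbrakk> \<Longrightarrow> x \<oplus> y \<in> I" "\<lbrakk>x \<in> I; y \<in> I\<rbrakk> \<Longrightarrow> x \<ominus> y \<in> I"
    by (auto simp: a_minus_def)
  show "\<lbrakk>a \<in> carrier A; x \<in> I\<rbrakk> \<Longrightarrow> a \<otimes> x \<in> I" by (rule I.I_l_closed)
  show "\<lbrakk>a \<in> carrier A; x \<in> I\<rbrakk> \<Longrightarrow> \<lbrace>a, x\<rbrace> \<in> I" by (rule I.pbracket_mem)
qed

lemma poisson_ideal_gen:
  assumes "S \<subseteq> carrier A"
  shows "poisson_ideal (gen_poisson_ideal A S) A"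
proof (rule poisson_idealI)
  have "poisson_ideal (carrier A) A"
    by (rule poisson_idealI) (auto simp: pbracket_closed)
  with assms show "gen_poisson_ideal A S \<subseteq> carrier A"
    unfolding gen_poisson_ideal_def by blast
qed (auto simp: gen_poisson_ideal_def intro: poisson_idealD)

lemma gen_poisson_ideal_superset: "S \<subseteq> gen_poisson_ideal A S"
  by (auto simp: gen_poisson_ideal_def)

lemma gen_poisson_ideal_least: "\<lbrakk>poisson_ideal I A; S \<subseteq> I\<rbrakk> \<Longrightarrow> gen_poisson_ideal A S \<subseteq> I"
  by (auto simp: gen_poisson_ideal_def)

end

text \<open>
  The union of the chain is a Poisson ideal, and its finitely many generators lie in one member.
\<close>

lemma (in poisson_noetherian) ascending_chain_stabilizes:
  assumes I: "\<And>n. poisson_ideal (I n) A" and mono: "\<And>n :: nat. I n \<subseteq> I (Suc n)"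
  obtains N where "\<And>n. I n \<subseteq> I N"
proof -
  have le: "I m \<subseteq> I n" if "m \<le> n" for m n
    using lift_Suc_mono_le[of I, OF mono that] .
  have "poisson_ideal (\<Union>n. I n) A"
  proof (rule poisson_idealI)
    fix x y assume "x \<in> (\<Union>n. I n)" "y \<in> (\<Union>n. I n)"
    then obtain m n where "x \<in> I m" "y \<in> I n" by auto
    then have "x \<in> I (max m n)" "y \<in> I (max m n)"
      using le[of m "max m n"] le[of n "max m n"] by auto
    then show "x \<oplus> y \<in> (\<Union>n. I n)" using poisson_idealD(3)[OF I] by blast
  next
    show "(\<Union>n. I n) \<subseteq> carrier A" using poisson_idealD(1)[OF I] by auto
    show "\<zero> \<in> (\<Union>n. I n)" using poisson_idealD(2)[OF I] by auto
    show "a \<otimes> x \<in> (\<Union>n. I n)" if "a \<in> carrier A" "x \<in> (\<Union>n. I n)" for a x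
      using that by (auto intro: poisson_idealD(5)[OF I])
    show "\<lbrace>a, x\<rbrace> \<in> (\<Union>n. I n)" if "a \<in> carrier A" "x \<in> (\<Union>n. I n)" for a x
      using that by (auto intro: poisson_idealD(6)[OF I])
  qed
  from finitely_generated[OF this] obtain S where S: "finite S" "(\<Union>n. I n) = gen_poisson_ideal A S"
    by (elim exE conjE)
  have "S \<subseteq> (\<Union>n. I n)"
    unfolding S(2) by (rule gen_poisson_ideal_superset)
  then have "\<forall>s\<in>S. \<exists>n. s \<in> I n" by auto
  then obtain N where N: "s \<in> S \<Longrightarrow> s \<in> I (N s)" for s
    by metis
  define M where "M = Max (insert 0 (N ` S))"
  have "S \<subseteq> I M"
  proof
    fix s assume s: "s \<in> S"
    then have "N s \<le> M" using S(1) unfolding M_def by (intro Max_ge) auto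
    with N[OF s] show "s \<in> I M" using le by auto
  qed
  then have "(\<Union>n. I n) \<subseteq> I M"
    unfolding S(2) by (rule gen_poisson_ideal_least[OF I])
  then have "I n \<subseteq> I M" for n by auto
  then show ?thesis by (rule that)
qed

section \<open>Leading coefficients\<close>

text \<open>
  Elements of smaller degree are admitted so that zero belongs to the set, which is then an ideal whenever
  \<open>I\<close> is one.
\<close>

definition lead_coeffs :: "('a, 'm) ring_scheme \<Rightarrow> (nat \<Rightarrow> 'a) set \<Rightarrow> nat \<Rightarrow> 'a set"
  where "lead_coeffs R I n = {coeff (UP R) p n | p. p \<in> I \<and> (\<forall>m > n. coeff (UP R) p m = \<zero>\<^bsub>R\<^esub>)}"

context UP_cring
begin

text \<open>
  The leading term of an element of \<open>I\<close> can be removed by subtracting an element of \<open>J\<close> with the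
  same leading term, and the degree drops.
\<close>

lemma eq_of_lead_coeffs_subset:
  assumes I: "I \<subseteq> carrier P" and "J \<subseteq> I"
    and "\<zero>\<^bsub>P\<^esub> \<in> J" and J_add: "\<And>p q. \<lbrakk>p \<in> J; q \<in> J\<rbrakk> \<Longrightarrow> p \<oplus>\<^bsub>P\<^esub> q \<in> J"
    and I_minus: "\<And>p q. \<lbrakk>p \<in> I; q \<in> I\<rbrakk> \<Longrightarrow> p \<ominus>\<^bsub>P\<^esub> q \<in> I"
    and lead: "\<And>n. lead_coeffs R I n \<subseteq> lead_coeffs R J n"
  shows "I = J"
proof -
  have "p \<in> J" if "p \<in> I" "\<forall>m \<ge> n. coeff P p m = \<zero>" for n p
    using that
  proof (induction n arbitrary: p)
    case 0
    then have "p = \<zero>\<^bsub>P\<^esub>"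
      using I by (intro up_eqI) auto
    with \<open>\<zero>\<^bsub>P\<^esub> \<in> J\<close> show ?case by simp
  next
    case (Suc n)
    then have "coeff P p n \<in> lead_coeffs R I n"
      by (auto simp: lead_coeffs_def P_def)
    then obtain q where q: "q \<in> J" "coeff P p n = coeff P q n" "\<forall>m > n. coeff P q m = \<zero>"
      using lead by (fastforce simp: lead_coeffs_def P_def)
    have pq: "p \<in> carrier P" "q \<in> carrier P" using Suc.prems(1) q(1) I \<open>J \<subseteq> I\<close> by auto
    have "coeff P (p \<ominus>\<^bsub>P\<^esub> q) m = \<zero>" if "m \<ge> n" for m
      using pq q Suc.prems(2) that by (cases "m = n") (auto simp: coeff_minus a_minus_def R.r_neg)
    moreover have "p \<ominus>\<^bsub>P\<^esub> q \<in> I"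
      using Suc.prems(1) q(1) \<open>J \<subseteq> I\<close> by (auto intro: I_minus)
    ultimately have "p \<ominus>\<^bsub>P\<^esub> q \<in> J" using Suc.IH by blast
    from J_add[OF this q(1)] show ?case
      using pq by (simp add: a_minus_def P.a_assoc P.l_neg)
  qed
  moreover have "\<exists>n. \<forall>m \<ge> n. coeff P p m = \<zero>" if "p \<in> I" for p
    using that I by (intro exI[of _ "Suc (deg R p)"]) (auto intro: deg_aboveD)
  ultimately show ?thesis using \<open>J \<subseteq> I\<close> by blast
qed

end

context poisson_pair
begin

interpretation P: UP_cring A "UP A"
  by (intro UP_cring.intro cring_axioms) simp

interpretation T: poisson_twist K "laurent_poisson A" "laurent_euler A" ore_derivation "laurent_map \<alpha> 0"
  by (rule poisson_twist_laurent)

text \<open>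
  The bracket with a constant does not raise the degree, because its Euler derivative is zero.
\<close>

lemma coeff_ore_bracket_const:
  assumes a: "a \<in> carrier A" and p: "p \<in> carrier (UP A)"
  shows "coeff (UP A) (ore_bracket A \<alpha> \<delta> (monom (UP A) a 0) p) n
    = \<lbrace>a, coeff (UP A) p n\<rbrace> \<oplus> ([int n] \<cdot> (\<alpha> a \<otimes> coeff (UP A) p n) \<oplus> [int (Suc n)] \<cdot> (\<delta> a \<otimes> coeff (UP A) p (Suc
        n)))"
proof -
  have B: "\<phi> p \<in> carrier B" "laurent_euler A (\<phi> p) \<in> carrier B"
    using p by (simp_all add: laurent_of_poly_closed T.closed)
  have mult: "(laurent_monom A b i \<otimes>\<^bsub>B\<^esub> f) m = b \<otimes> f (m - i)" if "b \<in> carrier A" "f \<in> carrier B" for b i f m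
    using that by (simp add: laurent_poisson_def laurent_mult_conv biadditive.conv_monom_left[OF
        biadditive_mult])
  have pbracket: "\<lbrace>laurent_monom A b i, f\<rbrace>\<^bsub>B\<^esub> m = \<lbrace>b, f (m - i)\<rbrace>" if "b \<in> carrier A" "f \<in> carrier B" for b i f m
    using that by (simp add: laurent_poisson_def biadditive.conv_monom_left[OF biadditive_pbracket])
  have in_A: "\<alpha> a \<in> carrier A" "\<delta> a \<in> carrier A" using a by (simp_all add: der_closed \<delta>.der_closed)
  have "coeff (UP A) (ore_bracket A \<alpha> \<delta> (monom (UP A) a 0) p) n
      = \<phi> (ore_bracket A \<alpha> \<delta> (monom (UP A) a 0) p) (int n)"
    by (simp add: laurent_of_poly_def)
  also have "\<phi> (ore_bracket A \<alpha> \<delta> (monom (UP A) a 0) p) = T.twisted_bracket (laurent_monom A a 0) (\<phi> p)"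
    using a p by (simp add: laurent_of_poly_ore_bracket laurent_of_poly_monom)
  also have "\<dots> = \<lbrace>laurent_monom A a 0, \<phi> p\<rbrace>\<^bsub>B\<^esub> \<oplus>\<^bsub>B\<^esub>
    (laurent_monom A (\<alpha> a) 0 \<otimes>\<^bsub>B\<^esub> laurent_euler A (\<phi> p) \<oplus>\<^bsub>B\<^esub> laurent_monom A (\<delta> a) (- 1) \<otimes>\<^bsub>B\<^esub> laurent_euler A (\<phi> p))"
  proof -
    have "laurent_euler A (laurent_monom A a 0) = \<zero>\<^bsub>B\<^esub>"
      by (simp add: laurent_euler_monom add_pow_def laurent_poisson_monom_zero)
    then show ?thesis
      using a B in_A
      by (simp add: T.twisted_bracket_def ore_derivation_monom laurent_poisson_monom_closed T.D.l_distr
          T.closed a_minus_def)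
  qed
  also have "\<dots> (int n) = \<lbrace>a, \<phi> p (int n)\<rbrace> \<oplus>
      (\<alpha> a \<otimes> laurent_euler A (\<phi> p) (int n) \<oplus> \<delta> a \<otimes> laurent_euler A (\<phi> p) (int n + 1))"
    using a in_A B by (simp add: laurent_poisson_add_apply mult pbracket)
  also have "\<dots> = \<lbrace>a, coeff (UP A) p n\<rbrace> \<oplus> ([int n] \<cdot> (\<alpha> a \<otimes> coeff (UP A) p n)
      \<oplus> [int (Suc n)] \<cdot> (\<delta> a \<otimes> coeff (UP A) p (Suc n)))"
  proof -
    have "\<phi> p (int n + 1) = coeff (UP A) p (Suc n)"
      by (simp add: laurent_of_poly_def nat_add_distrib)
    moreover have "\<phi> p (int n) = coeff (UP A) p n"
      by (simp add: laurent_of_poly_def)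
    ultimately show ?thesis
      using in_A p by (simp add: laurent_euler_def add_pow_rdistr_int add.commute)
  qed
  finally show ?thesis .
qed

text \<open>
  For \<open>p = b x^n + \<dots>\<close> in \<open>I\<close> the element \<open>{a, p}\<close> has leading coefficient
  \<open>{a, b} + n \<alpha>(a) b\<close>. The second summand is a multiple of \<open>b\<close> and belongs to the ideal of leading
  coefficients, so the first one does as well. Multiplication by the variable shows that these ideals increase
  with the degree.
\<close>

lemma poisson_ideal_lead_coeffs:
  assumes I: "poisson_ideal I (poisson_ore A \<alpha> \<delta>)"
  shows "poisson_ideal (lead_coeffs A I n) A" and "lead_coeffs A I n \<subseteq> lead_coeffs A I (Suc n)"
proof -
  interpret O: poisson_algebra K "poisson_ore A \<alpha> \<delta>" by (rule poisson_algebra_ore)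
  note I = O.poisson_idealD[OF I, unfolded poisson_ore_simps]
  have I_carrier: "p \<in> I \<Longrightarrow> p \<in> carrier (UP A)" for p using I(1) by auto
  have leadI: "coeff (UP A) p k \<in> lead_coeffs A I k" if "p \<in> I" "\<And>m. m > k \<Longrightarrow> coeff (UP A) p m = \<zero>" for p k
    using that by (auto simp: lead_coeffs_def)
  show mono: "lead_coeffs A I n \<subseteq> lead_coeffs A I (Suc n)"
  proof
    fix x assume "x \<in> lead_coeffs A I n"
    then obtain p where p: "p \<in> I" "x = coeff (UP A) p n" "\<And>m. m > n \<Longrightarrow> coeff (UP A) p m = \<zero>"
      by (auto simp: lead_coeffs_def)
    let ?q = "monom (UP A) \<one> 1 \<otimes>\<^bsub>UP A\<^esub> p"
    have shift: "coeff (UP A) ?q (Suc m) = coeff (UP A) p m" for m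
      using P.coeff_monom_mult[of \<one> p 1 m] I_carrier[OF p(1)] by simp
    have "coeff (UP A) ?q (Suc n) \<in> lead_coeffs A I (Suc n)"
    proof (rule leadI)
      show "?q \<in> I" using p(1) by (intro I(5)) simp_all
      show "coeff (UP A) ?q m = \<zero>" if "m > Suc n" for m
        using that shift[of "m - 1"] p(3)[of "m - 1"] by simp
    qed
    then show "x \<in> lead_coeffs A I (Suc n)" by (simp only: shift p(2))
  qed
  show "poisson_ideal (lead_coeffs A I n) A"
  proof (rule poisson_idealI)
    show "lead_coeffs A I n \<subseteq> carrier A"
      using I_carrier by (auto simp: lead_coeffs_def)
    show "\<zero> \<in> lead_coeffs A I n"
      using leadI[OF I(2), of n] by simp
    show add: "x \<oplus> y \<in> lead_coeffs A I n" if xy: "x \<in> lead_coeffs A I n" "y \<in> lead_coeffs A I n" for x y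
    proof -
      obtain p q where p: "p \<in> I" "x = coeff (UP A) p n" "\<forall>m > n. coeff (UP A) p m = \<zero>"
        and q: "q \<in> I" "y = coeff (UP A) q n" "\<forall>m > n. coeff (UP A) q m = \<zero>"
        using xy by (auto simp: lead_coeffs_def)
      then show ?thesis
        using leadI[OF I(3)[OF p(1) q(1)], of n] by (simp add: I_carrier)
    qed
    show mult: "a \<otimes> x \<in> lead_coeffs A I n" if a: "a \<in> carrier A" and x: "x \<in> lead_coeffs A I n" for a x
    proof -
      obtain p where p: "p \<in> I" "x = coeff (UP A) p n" "\<forall>m > n. coeff (UP A) p m = \<zero>"
        using x by (auto simp: lead_coeffs_def)
      have "monom (UP A) a 0 \<otimes>\<^bsub>UP A\<^esub> p \<in> I"
        using a p(1) by (intro I(5)) simp_all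
      with p show ?thesis
        using leadI[of "monom (UP A) a 0 \<otimes>\<^bsub>UP A\<^esub> p" n] a
        by (simp add: I_carrier P.monom_mult_is_smult)
    qed
    show "\<lbrace>a, x\<rbrace> \<in> lead_coeffs A I n" if a: "a \<in> carrier A" and x: "x \<in> lead_coeffs A I n" for a x
    proof -
      obtain p where p: "p \<in> I" "x = coeff (UP A) p n" "\<forall>m > n. coeff (UP A) p m = \<zero>"
        using x by (auto simp: lead_coeffs_def)
      let ?q = "ore_bracket A \<alpha> \<delta> (monom (UP A) a 0) p"
      have in_A: "x \<in> carrier A" "\<alpha> a \<in> carrier A" "\<delta> a \<in> carrier A"
        using a p by (simp_all add: I_carrier der_closed \<delta>.der_closed)
      have coeff: "coeff (UP A) ?q m = \<lbrace>a, coeff (UP A) p m\<rbrace> \<oplus> [int m] \<cdot> (\<alpha> a \<otimes> coeff (UP A) p m)" if "m \<ge> n"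
          for m
        using that a p in_A by (simp add: coeff_ore_bracket_const I_carrier pbracket_closed)
      have "coeff (UP A) ?q n \<in> lead_coeffs A I n"
      proof (rule leadI)
        show "?q \<in> I" using a p(1) by (intro I(6)) simp_all
        have "\<lbrace>a, \<zero>\<rbrace> = \<zero>" using a by (intro biadditive.b_zero_right[OF biadditive_pbracket])
        then show "coeff (UP A) ?q m = \<zero>" if "m > n" for m
          using that p in_A by (simp add: coeff)
      qed
      moreover have "(\<ominus> ([int n] \<cdot> \<alpha> a)) \<otimes> x \<in> lead_coeffs A I n"
        using in_A x by (intro mult) simp_all
      ultimately have "coeff (UP A) ?q n \<oplus> (\<ominus> ([int n] \<cdot> \<alpha> a)) \<otimes> x \<in> lead_coeffs A I n"
        by (rule add)
      also have "coeff (UP A) ?q n \<oplus> (\<ominus> ([int n] \<cdot> \<alpha> a)) \<otimes> x = \<lbrace>a, x\<rbrace>"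
        using a in_A p(2) by (simp add: coeff l_minus add_pow_ldistr_int M.a_assoc M.r_neg pbracket_closed)
      finally show ?thesis .
    qed
  qed
qed

section \<open>The Noetherian property\<close>

text \<open>
  Only finitely many of the ideals of leading coefficients are distinct. Finitely many elements of \<open>I\<close>
  have leading coefficients that generate all of them as Poisson ideals; the Poisson ideal that these elements
  generate has the same leading coefficients as \<open>I\<close>.
\<close>

theorem poisson_noetherian_ore:
  assumes "poisson_noetherian K A"
  shows "poisson_noetherian K (poisson_ore A \<alpha> \<delta>)"
proof (intro poisson_noetherian.intro poisson_noetherian_axioms.intro poisson_algebra_ore)
  interpret N: poisson_noetherian K A by fact
  let ?P = "poisson_ore A \<alpha> \<delta>"
  interpret O: poisson_algebra K ?P by (rule poisson_algebra_ore)
  fix I assume I: "poisson_ideal I ?P"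
  note I_lead = poisson_ideal_lead_coeffs[OF I]
  obtain N where N: "lead_coeffs A I n \<subseteq> lead_coeffs A I N" for n
    using N.ascending_chain_stabilizes[of "lead_coeffs A I", OF I_lead] by blast
  have "\<exists>S. finite S \<and> lead_coeffs A I n = gen_poisson_ideal A S" for n
    using N.finitely_generated[OF I_lead(1)] by blast
  then obtain S where S: "finite (S n)" "lead_coeffs A I n = gen_poisson_ideal A (S n)" for n
    by metis
  have "\<forall>s \<in> S n. \<exists>p \<in> I. coeff (UP A) p n = s \<and> (\<forall>m > n. coeff (UP A) p m = \<zero>)" for n
  proof -
    have "S n \<subseteq> lead_coeffs A I n"
      unfolding S(2) by (rule gen_poisson_ideal_superset)
    then show ?thesis by (auto simp: lead_coeffs_def)
  qed
  then obtain w where w: "s \<in> S n \<Longrightarrow> w n s \<in> I \<and> coeff (UP A) (w n s) n = s \<and> (\<forall>m > n. coeff (UP A) (w n s) m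
      = \<zero>)" for n s
    by metis
  define G where "G = (\<Union>n \<le> N. w n ` S n)"
  define J where "J = gen_poisson_ideal ?P G"
  have "finite G" "G \<subseteq> I"
    using S(1) w by (auto simp: G_def)
  then have G: "G \<subseteq> carrier ?P" using O.poisson_idealD(1)[OF I] by blast
  have J: "poisson_ideal J ?P" "J \<subseteq> I"
    unfolding J_def using O.poisson_ideal_gen[OF G] O.gen_poisson_ideal_least[OF I \<open>G \<subseteq> I\<close>] by auto
  note J_lead = poisson_ideal_lead_coeffs[OF J(1)]
  have le: "lead_coeffs A I n \<subseteq> lead_coeffs A J n" if "n \<le> N" for n
  proof -
    have "s \<in> lead_coeffs A J n" if s: "s \<in> S n" for s
    proof -
      have "w n s \<in> J"
        using O.gen_poisson_ideal_superset[of G] s \<open>n \<le> N\<close> by (auto simp: J_def G_def)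
      with w[OF s] show ?thesis
        unfolding lead_coeffs_def by (intro CollectI exI[of _ "w n s"]) simp
    qed
    then show ?thesis
      unfolding S(2) by (intro gen_poisson_ideal_least J_lead(1)) auto
  qed
  \<comment> \<open>Beyond \<open>N\<close> the ideals of \<open>I\<close> are constant, while those of \<open>J\<close> still increase.\<close>
  have "lead_coeffs A I n \<subseteq> lead_coeffs A J n" for n
  proof (cases "n \<le> N")
    case False
    have "lead_coeffs A I n \<subseteq> lead_coeffs A J N"
      using N[of n] le[of N] by auto
    also have "\<dots> \<subseteq> lead_coeffs A J n"
      using lift_Suc_mono_le[of "lead_coeffs A J", OF J_lead(2), of N n] False by simp
    finally show ?thesis .
  qed (rule le)
  moreover have "p \<ominus>\<^bsub>UP A\<^esub> q \<in> I" if "p \<in> I" "q \<in> I" for p q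
  proof -
    have "p \<ominus>\<^bsub>?P\<^esub> q = p \<ominus>\<^bsub>UP A\<^esub> q"
      by (simp add: a_minus_def a_inv_def m_inv_def poisson_ore_simps)
    with O.poisson_idealD(4)[OF I that] show ?thesis by simp
  qed
  ultimately have "I = J"
    using O.poisson_idealD(1)[OF I] O.poisson_idealD(2,3)[OF J(1)] J(2)
    by (intro P.eq_of_lead_coeffs_subset) (simp_all add: poisson_ore_simps)
  with \<open>finite G\<close> G show "\<exists>S. finite S \<and> S \<subseteq> carrier ?P \<and> I = gen_poisson_ideal ?P S"
    unfolding J_def by blast
qed

text \<open>
  The powers of \<open>x\<close> are units, so a Laurent polynomial is an ordinary one up to a unit. A Poisson
  ideal is therefore determined by its ordinary polynomials.
\<close>

lemma laurent_shift_polynomial: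
  assumes f: "f \<in> carrier B"
  obtains k p where "p \<in> carrier (UP A)" "laurent_monom A \<one> (int k) \<otimes>\<^bsub>B\<^esub> f = \<phi> p"
proof -
  have supp: "finite (laurent_supp A f)" using f by (simp add: laurent_poisson_def)
  define k where "k = Max (insert 0 ((\<lambda>i. nat \<bar>i\<bar>) ` laurent_supp A f))"
  have k: "f i = \<zero>" if "\<bar>i\<bar> > int k" for i
  proof (rule ccontr)
    assume "f i \<noteq> \<zero>"
    then have "nat \<bar>i\<bar> \<le> k"
      unfolding k_def using supp by (intro Max_ge) (auto simp: laurent_supp_def)
    with that show False by simp
  qed
  define p where "p = (\<lambda>n. f (int n - int k))"
  have "bound \<zero> (2 * k) p"
    by (rule bound.intro) (simp add: p_def k)
  then have p: "p \<in> up A"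
    using f by (intro mem_upI) (auto simp: p_def laurent_poisson_apply_closed)
  have "(laurent_monom A \<one> (int k) \<otimes>\<^bsub>B\<^esub> f) m = f (m - int k)" for m
    using f by (simp add: laurent_poisson_def laurent_mult_conv biadditive.conv_monom_left[OF biadditive_mult])
  moreover have "\<phi> p m = f (m - int k)" for m
    using p by (auto simp: laurent_of_poly_def UP_def p_def k)
  ultimately have "laurent_monom A \<one> (int k) \<otimes>\<^bsub>B\<^esub> f = \<phi> p"
    by auto
  moreover have "p \<in> carrier (UP A)" using p by (simp add: UP_def)
  ultimately show ?thesis using that by blast
qed

theorem poisson_noetherian_laurent_ore:
  assumes "poisson_noetherian K A"
  shows "poisson_noetherian K (poisson_laurent_ore A \<alpha> \<delta>)"
proof (intro poisson_noetherian.intro poisson_noetherian_axioms.intro poisson_algebra_laurent_ore)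
  let ?P = "poisson_ore A \<alpha> \<delta>" and ?L = "poisson_laurent_ore A \<alpha> \<delta>"
  interpret N: poisson_noetherian K ?P using assms by (rule poisson_noetherian_ore)
  interpret L: poisson_algebra K ?L by (rule poisson_algebra_laurent_ore)
  define contract where "contract I = {p \<in> carrier (UP A). \<phi> p \<in> I}" for I
  have contract: "poisson_ideal (contract I) ?P" if "poisson_ideal I ?L" for I
  proof (rule N.poisson_idealI)
    note I = L.poisson_idealD[OF that, unfolded poisson_laurent_ore_simps]
    have "\<phi> \<zero>\<^bsub>UP A\<^esub> = \<zero>\<^bsub>B\<^esub>"
      by (simp add: fun_eq_iff laurent_of_poly_def laurent_poisson_zero_apply)
    then show "\<zero>\<^bsub>?P\<^esub> \<in> contract I" using I(2) by (simp add: contract_def poisson_ore_simps)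
  qed (use L.poisson_idealD[OF that, unfolded poisson_laurent_ore_simps] in
      \<open>auto simp: contract_def poisson_ore_simps laurent_of_poly_add laurent_of_poly_mult
        laurent_of_poly_pbracket laurent_of_poly_closed ore_bracket_closed\<close>)
  fix I assume I: "poisson_ideal I ?L"
  obtain S where S: "finite S" "S \<subseteq> carrier (UP A)" "contract I = gen_poisson_ideal ?P S"
    using N.finitely_generated[OF contract[OF I]] by (auto simp: poisson_ore_simps)
  define J where "J = gen_poisson_ideal ?L (\<phi> ` S)"
  have "\<phi> ` S \<subseteq> I"
    using N.gen_poisson_ideal_superset[of S] S(3) by (auto simp: contract_def)
  have carrier: "\<phi> ` S \<subseteq> carrier ?L"
    using S(2) by (auto simp: poisson_laurent_ore_simps laurent_of_poly_closed)
  have J: "poisson_ideal J ?L" "J \<subseteq> I"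
    unfolding J_def using L.poisson_ideal_gen[OF carrier] L.gen_poisson_ideal_least[OF I \<open>\<phi> ` S \<subseteq> I\<close>] by auto
  have "S \<subseteq> contract J"
    using L.gen_poisson_ideal_superset[of "\<phi> ` S"] S(2) by (auto simp: contract_def J_def)
  then have contract_subset: "contract I \<subseteq> contract J"
    unfolding S(3) by (intro N.gen_poisson_ideal_least contract J(1))
  note I' = L.poisson_idealD[OF I, unfolded poisson_laurent_ore_simps]
    and J' = L.poisson_idealD[OF J(1), unfolded poisson_laurent_ore_simps]
  have "I \<subseteq> J"
  proof
    fix f assume "f \<in> I"
    then have f: "f \<in> carrier B" using I'(1) by auto
    obtain k p where p: "p \<in> carrier (UP A)" "laurent_monom A \<one> (int k) \<otimes>\<^bsub>B\<^esub> f = \<phi> p"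
      using laurent_shift_polynomial[OF f] .
    have "\<phi> p \<in> I"
      unfolding p(2)[symmetric] using \<open>f \<in> I\<close> by (intro I'(5)) (simp_all add: laurent_poisson_monom_closed)
    with p(1) have "\<phi> p \<in> J" using contract_subset by (auto simp: contract_def)
    then have "laurent_monom A \<one> (- int k) \<otimes>\<^bsub>B\<^esub> \<phi> p \<in> J"
      by (intro J'(5)) (simp_all add: laurent_poisson_monom_closed)
    also have "laurent_monom A \<one> (- int k) \<otimes>\<^bsub>B\<^esub> \<phi> p = f"
    proof -
      have "\<one>\<^bsub>B\<^esub> = laurent_monom A \<one> 0"
        by (simp add: laurent_poisson_def laurent_one_monom)
      then show ?thesis
        using f by (simp add: p(2)[symmetric] T.D.m_assoc[symmetric] laurent_poisson_monom_closed
            laurent_poisson_monom_mult flip: \<open>\<one>\<^bsub>B\<^esub> = _\<close>)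
    qed
    finally show "f \<in> J" .
  qed
  with J(2) S(1) carrier show "\<exists>S. finite S \<and> S \<subseteq> carrier ?L \<and> I = gen_poisson_ideal ?L S"
    unfolding J_def by blast
qed

end

theorem theorem1:
  fixes K :: "('k, 'm) ring_scheme"
    and A :: "('k, 'a, 'n) poisson_scheme"
    and \<alpha> \<delta> :: "'a \<Rightarrow> 'a"
  assumes "poisson_noetherian K A"
    and "poisson_pair K A \<alpha> \<delta>"
  shows "poisson_noetherian K (poisson_ore A \<alpha> \<delta>) \<and>
         poisson_noetherian K (poisson_laurent_ore A \<alpha> \<delta>)"
  using poisson_pair.poisson_noetherian_ore[OF assms(2,1)]
    poisson_pair.poisson_noetherian_laurent_ore[OF assms(2,1)] by simp

end
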